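(* Fix $0<p<1$ and define, for bounded operators $T$ on $L^2(\mu_p)$, $$\Psi(T)=P_\phi+pU_0TU_0^*+(1-p)U_2TU_2^*.$$ Then: (1) for every $m\ge0$, $K_{m+1}=\Psi(K_m)$, and in particular $K_m=\Psi^m(P_\phi)$; (2) $K_\infty=\Psi(K_\infty)$, i.e. $K_\infty=P_\phi+pU_0K_\infty U_0^*+(1-p)U_2K_\infty U_2^*$; (3) $K_\infty$ is the unique bounded operator $T$ on $L^2(\mu_p)$ satisfying $T=\Psi(T)$.
   Context: Let $S_0(x)=x/3$, $S_2(x)=(x+2)/3$ on $[0,1]$ and let $C$ be the middle-third Cantor set. For $0<p<1$, $\mu_p$ is the unique Borel probability measure on $[0,1]$ with $\mu_p=p\,\mu_p\circ S_0^{-1}+(1-p)\,\mu_p\circ S_2^{-1}$. For words $w\in\{0,2\}^n$, $S_w=S_{w_1}\circ\cdots\circ S_{w_n}$, $C_w=S_w(C)$. Inner product $\langle f,g\rangle=\int\overline fg\,d\mu_p$; $\phi=1_C$ and $P_\phi f=\langle\phi,f\rangle\phi$. $K_mf=\sum_{|u|\le m}\langle1_{C_u},f\rangle1_{C_u}$ and $K_\infty=\lim_{m\to\infty}K_m$ in operator norm (this limit exists). $U_0,U_2$ are defined by $(U_0f)(x)=p^{-1/2}1_{C_0}(x)f(S_0^{-1}(x))$, $(U_2f)(x)=(1-p)^{-1/2}1_{C_2}(x)f(S_2^{-1}(x))$. *)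

theory Defs
  imports "HOL-Analysis.Analysis"
begin

definition S0 :: "real \<Rightarrow> real" where "S0 x = x / 3"
definition S2 :: "real \<Rightarrow> real" where "S2 x = (x + 2) / 3"

definition S0inv :: "real \<Rightarrow> real" where "S0inv x = 3 * x"
definition S2inv :: "real \<Rightarrow> real" where "S2inv x = 3 * x - 2"

fun cantor_level :: "nat \<Rightarrow> real set" where
  "cantor_level 0 = {0..1}"
| "cantor_level (Suc n) = S0 ` cantor_level n \<union> S2 ` cantor_level n"

definition cantor :: "real set" where "cantor = (\<Inter>n. cantor_level n)"

definition Smap :: "nat \<Rightarrow> real \<Rightarrow> real" where
  "Smap a = (if a = 0 then S0 else S2)"

fun Sw :: "nat list \<Rightarrow> real \<Rightarrow> real" where
  "Sw [] = id"
| "Sw (a # w) = Smap a \<circ> Sw w"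

definition Cw :: "nat list \<Rightarrow> real set" where "Cw w = Sw w ` cantor"

definition words_upto :: "nat \<Rightarrow> nat list set" where
  "words_upto m = {w. set w \<subseteq> {0, 2} \<and> length w \<le> m}"

definition mu :: "real \<Rightarrow> real measure" where
  "mu p = (THE M. sets M = sets borel \<and> emeasure M (space M) = 1 \<and> emeasure M (- {0..1}) = 0 \<and>
      (\<forall>A \<in> sets borel. emeasure M A =
          ennreal p * emeasure M (S0 -` A) + ennreal (1 - p) * emeasure M (S2 -` A)))"

definition L2 :: "real measure \<Rightarrow> (real \<Rightarrow> complex) set" where
  "L2 M = {f. f \<in> borel_measurable M \<and> integrable M (\<lambda>x. (cmod (f x))\<^sup>2)}"

definition L2inner :: "real measure \<Rightarrow> (real \<Rightarrow> complex) \<Rightarrow> (real \<Rightarrow> complex) \<Rightarrow> complex" where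
  "L2inner M f g = integral\<^sup>L M (\<lambda>x. cnj (f x) * g x)"

definition L2norm :: "real measure \<Rightarrow> (real \<Rightarrow> complex) \<Rightarrow> real" where
  "L2norm M f = sqrt (integral\<^sup>L M (\<lambda>x. (cmod (f x))\<^sup>2))"

type_synonym op = "(real \<Rightarrow> complex) \<Rightarrow> (real \<Rightarrow> complex)"

text \<open>Bounded (linear) operator on L^2(M), acting on representatives.\<close>
definition bdd_op :: "real measure \<Rightarrow> op \<Rightarrow> bool" where
  "bdd_op M T \<longleftrightarrow>
     (\<forall>f \<in> L2 M. T f \<in> L2 M) \<and>
     (\<forall>f \<in> L2 M. \<forall>g \<in> L2 M. (AE x in M. f x = g x) \<longrightarrow> (AE x in M. T f x = T g x)) \<and>
     (\<forall>f \<in> L2 M. \<forall>g \<in> L2 M. \<forall>a b. AE x in M. T (\<lambda>y. a * f y + b * g y) x = a * T f x + b * T g x) \<and>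
     (\<exists>C. \<forall>f \<in> L2 M. L2norm M (T f) \<le> C * L2norm M f)"

definition op_eq :: "real measure \<Rightarrow> op \<Rightarrow> op \<Rightarrow> bool" where
  "op_eq M T S \<longleftrightarrow> (\<forall>f \<in> L2 M. AE x in M. T f x = S f x)"

definition op_dist :: "real measure \<Rightarrow> op \<Rightarrow> op \<Rightarrow> real" where
  "op_dist M T S = Sup {L2norm M (\<lambda>x. T f x - S f x) | f. f \<in> L2 M \<and> L2norm M f \<le> 1}"

definition adjoint :: "real measure \<Rightarrow> op \<Rightarrow> op" where
  "adjoint M U = (SOME V. bdd_op M V \<and>
      (\<forall>f \<in> L2 M. \<forall>g \<in> L2 M. L2inner M (U f) g = L2inner M f (V g)))"

definition phi :: "real \<Rightarrow> complex" where "phi = indicator cantor"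

definition Pphi :: "real \<Rightarrow> op" where
  "Pphi p f = (\<lambda>x. L2inner (mu p) phi f * phi x)"

definition K :: "real \<Rightarrow> nat \<Rightarrow> op" where
  "K p m f = (\<lambda>x. \<Sum>u \<in> words_upto m.
      L2inner (mu p) (indicator (Cw u)) f * indicator (Cw u) x)"

definition K_inf :: "real \<Rightarrow> op" where
  "K_inf p = (SOME T. bdd_op (mu p) T \<and> (\<lambda>m. op_dist (mu p) (K p m) T) \<longlonglongrightarrow> 0)"

definition U0 :: "real \<Rightarrow> op" where
  "U0 p f = (\<lambda>x. complex_of_real (p powr (-1/2)) * indicator (Cw [0]) x * f (S0inv x))"

definition U2 :: "real \<Rightarrow> op" where
  "U2 p f = (\<lambda>x. complex_of_real ((1 - p) powr (-1/2)) * indicator (Cw [2]) x * f (S2inv x))"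

definition Psi :: "real \<Rightarrow> op \<Rightarrow> op" where
  "Psi p T f = (\<lambda>x. Pphi p f x
      + complex_of_real p * U0 p (T (adjoint (mu p) (U0 p) f)) x
      + complex_of_real (1 - p) * U2 p (T (adjoint (mu p) (U2 p) f)) x)"

end

theory Submission
  imports Defs "HOL-Probability.Probability" "HOL-Probability.Stream_Space"
begin

text \<open>
  The measure is the law of a sum of independent digits. Its self-similarity gives
  \<open>1_{C_a} \<mu> = w_a \<mu> \<circ> S_a\<^sup>-\<^sup>1\<close>, so that the adjoint of \<open>U_a\<close> is \<open>f \<mapsto> sqrt w_a f \<circ> S_a\<close>,
  and moving the indicators of cylinders through this adjoint turns \<open>\<Psi>(K_m)\<close> into \<open>K_{m+1}\<close>
  word by word. At any point at most one of the two branches of \<open>\<Psi>\<close> contributes, with factor at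
  most \<open>r = sqrt (max p (1-p)) < 1\<close>; hence \<open>K_m f\<close> converges geometrically and uniformly in \<open>x\<close>,
  which produces \<open>K_\<infinity>\<close> without completeness of \<open>L\<^sup>2\<close>.
  The difference \<open>R\<close> of two bounded fixed points satisfies
  \<open>\<parallel>R f\<parallel>\<^sup>2 = p\<^sup>2 \<parallel>R U\<^sub>0\<^sup>* f\<parallel>\<^sup>2 + (1-p)\<^sup>2 \<parallel>R U\<^sub>2\<^sup>* f\<parallel>\<^sup>2\<close> because the \<open>U_a\<close> are isometries with
  orthogonal ranges, and \<open>\<parallel>U\<^sub>0\<^sup>* f\<parallel>\<^sup>2 + \<parallel>U\<^sub>2\<^sup>* f\<parallel>\<^sup>2 = \<parallel>f\<parallel>\<^sup>2\<close>; iterating forces \<open>R = 0\<close>.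
\<close>

section \<open>Existence and uniqueness of the self-similar measure\<close>

text \<open>The condition under the \<open>THE\<close> of \<open>mu_def\<close>, named so that
  existence and uniqueness can be proved separately.\<close>

definition self_similar :: "real \<Rightarrow> real measure \<Rightarrow> bool" where
  "self_similar p M \<longleftrightarrow> sets M = sets borel \<and> emeasure M (space M) = 1 \<and> emeasure M (- {0..1}) = 0 \<and>
      (\<forall>A \<in> sets borel. emeasure M A =
          ennreal p * emeasure M (S0 -` A) + ennreal (1 - p) * emeasure M (S2 -` A))"

text \<open>A ternary expansion with digits 0 and 2. \<open>True\<close> stands for the digit 0, so
  that flips drawn from \<open>bernoulli_pmf p\<close> give this digit the probability
  \<open>p\<close>.\<close>

definition coding :: "bool stream \<Rightarrow> real" where
  "coding s = (\<Sum>n. (if s !! n then 0 else 2) / 3 ^ Suc n)"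

lemma coding_summable: "summable (\<lambda>n. (if s !! n then 0 else 2) / 3 ^ Suc n :: real)"
proof (rule summable_comparison_test'[where g="\<lambda>n. 2/3 * (1/3)^n" and N=0])
  show "summable (\<lambda>n. 2/3 * (1/3::real)^n)" by (intro summable_mult summable_geometric) simp
qed (auto simp: power_one_over)

lemma coding_Stream: "coding (b ## s) = (if b then S0 (coding s) else S2 (coding s))"
proof -
  have "coding (b ## s) = (if b then 0 else 2) / 3 + (\<Sum>n. (if s !! n then 0 else 2) / 3 ^ Suc n / 3)"
    unfolding coding_def using suminf_split_head[OF coding_summable[of "b ## s"]] by simp
  also have "(\<Sum>n. (if s !! n then 0 else 2) / 3 ^ Suc n / 3) = coding s / 3"
    unfolding coding_def by (rule suminf_divide[OF coding_summable])
  finally show ?thesis by (simp add: S0_def S2_def add_divide_distrib)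
qed

lemma coding_range: "coding s \<in> {0..1}"
proof -
  have s: "(\<lambda>n. 2/3 * (1/3::real)^n) sums (2/3 * (1 / (1 - 1/3)))"
    by (intro sums_mult geometric_sums) simp
  have "coding s \<le> (\<Sum>n. 2/3 * (1/3)^n)"
    unfolding coding_def
    by (intro suminf_le coding_summable sums_summable[OF s]) (auto simp: power_one_over field_simps)
  moreover have "0 \<le> coding s"
    unfolding coding_def by (intro suminf_nonneg coding_summable) auto
  ultimately show ?thesis using sums_unique[OF s] by simp
qed

text \<open>The witness is the law of \<open>coding\<close> under independent coin flips.
  Conditioning on the first flip gives the self-similarity equation, because prepending a flip
  applies \<open>S0\<close> or \<open>S2\<close> to the code.\<close>

lemma self_similar_exists:
  assumes "0 < p" "p < 1"
  shows "\<exists>M. self_similar p M"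
proof -
  let ?S = "stream_space (measure_pmf (bernoulli_pmf p))"
  interpret S: prob_space ?S by (rule prob_space.prob_space_stream_space[OF measure_pmf.prob_space_axioms])
  have [measurable]: "coding \<in> borel_measurable ?S" unfolding coding_def by measurable
  have sp: "space ?S = UNIV" by (simp add: space_stream_space)
  let ?M = "distr ?S borel coding"
  have "emeasure ?M A = ennreal p * emeasure ?M (S0 -` A) + ennreal (1 - p) * emeasure ?M (S2 -` A)"
    if [measurable]: "A \<in> sets borel" for A
  proof -
    have m: "S0 \<in> borel_measurable borel" "S2 \<in> borel_measurable borel"
      unfolding S0_def S2_def by measurable
    have [measurable]: "S0 -` A \<in> sets borel" "S2 -` A \<in> sets borel"
      using measurable_sets[OF m(1) that] measurable_sets[OF m(2) that] by simp_all
    have "emeasure ?M A = (\<integral>\<^sup>+b. emeasure ?S {s\<in>space ?S. b ## s \<in> coding -` A} \<partial>bernoulli_pmf p)"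
      using measurable_sets[of coding ?S borel A]
      by (subst emeasure_distr) (auto simp: prob_space.emeasure_stream_space[OF measure_pmf.prob_space_axioms] sp)
    also have "\<dots> = ennreal p * emeasure ?S (coding -` (S0 -` A)) + ennreal (1 - p) * emeasure ?S (coding -` (S2 -` A))"
      using assms by (simp add: sp coding_Stream vimage_def mult.commute)
    finally show ?thesis by (simp add: emeasure_distr sp)
  qed
  moreover have "emeasure ?M (- {0..1}) = 0"
    using coding_range by (subst emeasure_distr) (auto simp: vimage_def)
  moreover have "emeasure ?M (space ?M) = 1"
    by (rule prob_space.emeasure_space_1[OF S.prob_space_distr]) simp
  ultimately have "self_similar p ?M"
    unfolding self_similar_def by (intro conjI ballI sets_distr)
  then show ?thesis by blast
qed

section \<open>Uniqueness through distribution functions\<close>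

lemma self_similarD:
  assumes "self_similar p M"
  shows "sets M = sets borel" "emeasure M (space M) = 1" "emeasure M (- {0..1}) = 0"
    and "A \<in> sets borel \<Longrightarrow>
      emeasure M A = ennreal p * emeasure M (S0 -` A) + ennreal (1 - p) * emeasure M (S2 -` A)"
  using assms unfolding self_similar_def by blast+

lemma self_similar_real_distribution:
  assumes "self_similar p M" shows "real_distribution M"
  using self_similarD(1,2)[OF assms]
  by (auto simp: real_distribution_def real_distribution_axioms_def intro!: prob_spaceI)

text \<open>Half-lines pull back to half-lines under \<open>S0\<close> and \<open>S2\<close>, which
  turns self-similarity into a functional equation. The strict bound at 0 leaves room for an atom
  there, which \<open>cdf\<close> would already count at 0.\<close>

lemma self_similar_cdf:
  assumes p: "0 < p" "p < 1" and M: "self_similar p M"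
  shows "x < 0 \<Longrightarrow> cdf M x = 0" "x \<ge> 1 \<Longrightarrow> cdf M x = 1"
    "cdf M x = p * cdf M (3 * x) + (1 - p) * cdf M (3 * x - 2)"
proof -
  interpret real_distribution M by (rule self_similar_real_distribution[OF M])
  have z: "emeasure M (- {0..1}) = 0" using M by (rule self_similarD)
  show "cdf M x = 0" if "x < 0"
    using z emeasure_mono[of "{..x}" "- {0..1}" M] that
    by (auto simp: cdf_def measure_def subset_eq)
  have z': "- {0..1::real} \<in> null_sets M" using z by auto
  show "cdf M x = 1" if "x \<ge> 1"
  proof -
    have "AE y in M. y \<in> {..x}"
      by (rule eventually_mono[OF AE_not_in[OF z']]) (use that in auto)
    then show ?thesis unfolding cdf_def by (subst prob_eq_1) auto
  qed
  have v: "S0 -` {..x} = {..3 * x}" "S2 -` {..x} = {..3 * x - 2}"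
    by (auto simp: S0_def S2_def)
  have "ennreal (cdf M x) = ennreal p * ennreal (cdf M (3 * x)) + ennreal (1 - p) * ennreal (cdf M (3 * x - 2))"
    using self_similarD(4)[OF M, of "{..x}"] v by (simp add: cdf_def emeasure_eq_measure)
  also have "\<dots> = ennreal (p * cdf M (3 * x) + (1 - p) * cdf M (3 * x - 2))"
    using p cdf_nonneg by (simp add: ennreal_mult'' ennreal_plus)
  finally show "cdf M x = p * cdf M (3 * x) + (1 - p) * cdf M (3 * x - 2)"
    using p cdf_nonneg by (subst (asm) ennreal_inj) auto
qed

text \<open>
  The difference of two distribution functions vanishes outside \<open>[0,1)\<close>, so at each point only one
  of the two terms of its self-similarity equation survives and the sup norm contracts.
\<close>
lemma self_similar_unique:
  assumes p: "0 < p" "p < 1" and M: "self_similar p M" and N: "self_similar p N"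
  shows "M = N"
proof -
  interpret M: real_distribution M by (rule self_similar_real_distribution[OF M])
  interpret N: real_distribution N by (rule self_similar_real_distribution[OF N])
  define d where "d x = cdf M x - cdf N x" for x
  define q where "q = max p (1 - p)"
  have q: "0 \<le> q" "q < 1" "p \<le> q" "1 - p \<le> q" using p by (auto simp: q_def)
  have d0: "d x = 0" if "x < 0 \<or> x \<ge> 1" for x
    using that self_similar_cdf(1,2)[OF p M] self_similar_cdf(1,2)[OF p N] by (auto simp: d_def)
  have rec: "d x = p * d (3 * x) + (1 - p) * d (3 * x - 2)" for x
    unfolding d_def by (subst (1 2) self_similar_cdf(3)[OF p]) (auto simp: M N algebra_simps)
  have bd: "\<bar>d x\<bar> \<le> q ^ n" for n x
  proof (induction n arbitrary: x)
    case 0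
    show ?case using M.cdf_nonneg[of x] N.cdf_nonneg[of x] M.cdf_bounded_prob[of x] N.cdf_bounded_prob[of x]
      by (auto simp: d_def)
  next
    case (Suc n)
    have "d x = p * d (3 * x) \<or> d x = (1 - p) * d (3 * x - 2)"
      using rec[of x] d0[of "3 * x"] d0[of "3 * x - 2"] by (cases "3 * x \<ge> 1") auto
    then show ?case
      using mult_mono[OF q(3) Suc[of "3 * x"]] mult_mono[OF q(4) Suc[of "3 * x - 2"]] p q
      by (auto simp: abs_mult)
  qed
  have "d x = 0" for x
  proof -
    have "\<bar>d x\<bar> \<le> 0"
      by (rule LIMSEQ_le_const[OF LIMSEQ_realpow_zero[OF q(1,2)]]) (use bd in auto)
    then show ?thesis by simp
  qed
  then have "cdf M = cdf N" by (auto simp: d_def fun_eq_iff)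
  then show ?thesis by (intro cdf_unique M.real_distribution_axioms N.real_distribution_axioms)
qed

text \<open>Existence and uniqueness together make the definite description in \<open>mu_def\<close>
  denote.\<close>

lemma self_similar_mu:
  assumes "0 < p" "p < 1" shows "self_similar p (mu p)"
proof -
  have "\<exists>!M. self_similar p M"
    using self_similar_exists self_similar_unique assms by blast
  then have "self_similar p (THE M. self_similar p M)" by (rule theI')
  moreover have "mu p = (THE M. self_similar p M)"
    unfolding mu_def self_similar_def ..
  ultimately show ?thesis by simp
qed

section \<open>Cylinder sets and change of variables\<close>

text \<open>Each letter doubles as the translation in its branch, so later arguments can treat both
  branches at once.\<close>

lemma Smap_alt: "a \<in> {0, 2} \<Longrightarrow> Smap a x = (x + real a) / 3"
  by (auto simp: Smap_def S0_def S2_def)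

lemma cantor_level_range: "cantor_level n \<subseteq> {0..1}"
  by (induction n) (auto simp: S0_def S2_def subset_eq)

lemma compact_cantor_level: "compact (cantor_level n)"
  by (induction n)
     (auto intro!: compact_Un compact_continuous_image continuous_intros simp: S0_def[abs_def] S2_def[abs_def])

lemma cantor_range: "cantor \<subseteq> {0..1}"
  unfolding cantor_def using cantor_level_range[of 0] by blast

lemma compact_cantor: "compact cantor"
  unfolding cantor_def
  by (rule compact_Inter) (auto simp: compact_cantor_level)

lemma Smap_cantor:
  assumes "x \<in> cantor" shows "Smap a x \<in> cantor"
proof -
  have "Smap a x \<in> cantor_level n" for n
  proof (cases n)
    case 0
    have "x \<in> {0..1}" using assms cantor_range by auto
    then show ?thesis by (auto simp: 0 Smap_def S0_def S2_def)
  next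
    case (Suc k)
    have "x \<in> cantor_level k" using assms by (auto simp: cantor_def)
    then show ?thesis by (auto simp: Suc Smap_def)
  qed
  then show ?thesis by (auto simp: cantor_def)
qed

lemma Cw_Nil: "Cw [] = cantor"
  by (simp add: Cw_def)

lemma Cw_Cons: "Cw (a # u) = Smap a ` Cw u"
  by (simp add: Cw_def image_comp)

lemma Cw_subset: "Cw u \<subseteq> cantor"
  by (induction u) (auto simp: Cw_Nil Cw_Cons intro: Smap_cantor)

lemma compact_Cw: "compact (Cw u)"
proof (induction u)
  case (Cons a u)
  have "continuous_on (Cw u) (Smap a)"
    by (cases "a = 0") (auto simp: Smap_def S0_def[abs_def] S2_def[abs_def] intro!: continuous_intros)
  then show ?case using Cons by (auto simp: Cw_Cons intro: compact_continuous_image)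
qed (simp add: Cw_Nil compact_cantor)

lemma sets_Cw [measurable]: "Cw u \<in> sets borel"
  by (intro borel_closed compact_imp_closed compact_Cw)

lemma mem_Cw_Cons_iff:
  assumes "a \<in> {0, 2}" shows "x \<in> Cw (a # u) \<longleftrightarrow> 3 * x - real a \<in> Cw u"
proof -
  have "x = Smap a y \<longleftrightarrow> y = 3 * x - real a" for y
    using assms by (simp add: Smap_alt field_simps) linarith
  then show ?thesis by (auto simp: Cw_Cons image_iff)
qed

text \<open>The right-hand side has the shape of \<open>U a\<close> applied to the indicator of
  \<open>Cw u\<close>, up to a scalar. It holds because \<open>Cw u\<close> lies in
  \<open>cantor\<close>, so that membership in \<open>Cw (a # u)\<close> entails membership in
  \<open>Cw [a]\<close>.\<close>

lemma indicator_Cw_Cons: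
  assumes "a \<in> {0, 2}"
  shows "indicator (Cw (a # u)) x = (indicator (Cw [a]) x * indicator (Cw u) (3 * x - real a) :: 'a::semiring_1)"
  using assms Cw_subset[of u] by (auto simp: indicator_def mem_Cw_Cons_iff Cw_Nil)

lemma Cw_0_2_disjoint: "Cw [0] \<inter> Cw [2] = {}"
proof -
  have "x \<notin> Cw [2]" if "x \<in> Cw [0]" for x
  proof
    assume "x \<in> Cw [2]"
    then have "3 * x - 2 \<in> cantor" using mem_Cw_Cons_iff[of 2 x "[]"] by (simp add: Cw_Nil)
    moreover have "3 * x \<in> cantor" using that mem_Cw_Cons_iff[of 0 x "[]"] by (simp add: Cw_Nil)
    ultimately have "3 * x - 2 \<in> {0..1}" "3 * x \<in> {0..1}" using cantor_range by blast+
    then show False by auto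
  qed
  then show ?thesis by blast
qed

lemma Smap_measurable [measurable]: "Smap a \<in> borel_measurable borel"
  by (cases "a = 0") (auto simp: Smap_def S0_def[abs_def] S2_def[abs_def])

section \<open>Integration over the first-level cylinders\<close>

locale cantor_measure =
  fixes p :: real
  assumes p_pos: "0 < p" and p_less: "p < 1"
begin

abbreviation "M \<equiv> mu p"

text \<open>Total in the letter: every nonzero \<open>a\<close> is treated like 2, so
  \<open>w_pos\<close> and \<open>sqrt_w_le\<close> carry no side condition.\<close>

definition w :: "nat \<Rightarrow> real" where "w a = (if a = 0 then p else 1 - p)"

lemma w_pos: "0 < w a"
  using p_pos p_less by (auto simp: w_def)

lemma w_02: "w 0 = p" "w 2 = 1 - p"
  by (auto simp: w_def)

sublocale real_distribution M
  by (rule self_similar_real_distribution[OF self_similar_mu[OF p_pos p_less]])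

lemma emeasure_split:
  "A \<in> sets borel \<Longrightarrow> emeasure M A =
     ennreal (w 0) * emeasure M (Smap 0 -` A) + ennreal (w 2) * emeasure M (Smap 2 -` A)"
  using self_similarD(4)[OF self_similar_mu[OF p_pos p_less], of A] by (simp add: w_def Smap_def)

text \<open>Both branches map one level into the next. By induction both preimages of the next level
  have full measure, and the two weights add up to 1.\<close>

lemma AE_cantor_level: "AE x in M. x \<in> cantor_level n"
proof (induction n)
  case 0
  have "emeasure M (- {0..1}) = 0"
    by (rule self_similarD[OF self_similar_mu[OF p_pos p_less]])
  then have "- {0..1} \<in> null_sets M" by auto
  from AE_not_in[OF this] show ?case by simp
next
  case (Suc n)
  have m: "cantor_level k \<in> sets borel" for k
    using compact_cantor_level[of k] by (intro borel_closed compact_imp_closed)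
  have 1: "emeasure M (Smap a -` cantor_level (Suc n)) = 1" for a
  proof -
    have "AE x in M. x \<in> Smap a -` cantor_level (Suc n)"
      by (rule eventually_mono[OF Suc]) (auto simp: Smap_def)
    moreover have "Smap a -` cantor_level (Suc n) \<in> sets borel"
      using measurable_sets[OF Smap_measurable m[of "Suc n"], of a] unfolding space_borel Int_UNIV_right .
    ultimately show ?thesis by (intro emeasure_eq_1_AE) auto
  qed
  have "emeasure M (cantor_level (Suc n)) = ennreal (w 0) + ennreal (w 2)"
    using 1[of 0] 1[of 2] by (subst emeasure_split[OF m]) simp
  also have "\<dots> = 1"
    using p_pos p_less by (subst ennreal_plus[symmetric]) (auto simp: w_def)
  finally have "prob (cantor_level (Suc n)) = 1"
    by (simp add: measure_def)
  then show ?case by (subst (asm) prob_eq_1) (simp_all only: events_eq_borel m)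
qed

lemma AE_cantor: "AE x in M. x \<in> cantor"
  using AE_cantor_level by (auto simp: cantor_def AE_all_countable)

text \<open>Almost every point lies in \<open>cantor\<close>, where the branch \<open>a\<close> maps
  into \<open>Cw [a]\<close> and the other branch into the disjoint cylinder. Only one term of the
  self-similarity equation survives.\<close>

lemma emeasure_Int_Cw:
  assumes a: "a \<in> {0, 2}" and A[measurable]: "A \<in> sets borel"
  shows "emeasure M (Cw [a] \<inter> A) = ennreal (w a) * emeasure M (Smap a -` A)"
proof -
  have 1: "emeasure M (Smap b -` (Cw [a] \<inter> A)) = (if a = b then emeasure M (Smap a -` A) else 0)"
    if b: "b \<in> {0, 2}" for b
  proof -
    have m: "Smap b -` B \<in> sets M" if "B \<in> sets borel" for B
      using measurable_sets[OF Smap_measurable that, of b] by simp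
    have *: "Cw [a] \<inter> A \<in> sets borel" by measurable
    show ?thesis
    proof (cases "a = b")
      case True
      have "Smap b x \<in> Cw [a]" if "x \<in> cantor" for x
        using that True by (auto simp: Cw_Cons Cw_Nil)
      then have "emeasure M (Smap b -` (Cw [a] \<inter> A)) = emeasure M (Smap b -` A)"
        by (intro emeasure_eq_AE m * A eventually_mono[OF AE_cantor]) auto
      then show ?thesis using True by simp
    next
      case False
      have "Smap b x \<notin> Cw [a]" if "x \<in> cantor" for x
        using that False a b Cw_0_2_disjoint by (auto simp: Cw_Cons Cw_Nil)
      then have "emeasure M (Smap b -` (Cw [a] \<inter> A)) = emeasure M {}"
        by (intro emeasure_eq_AE m * eventually_mono[OF AE_cantor]) auto
      then show ?thesis using False by simp
    qed
  qed
  show ?thesis using a 1[of 0] 1[of 2] by (subst emeasure_split) auto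
qed

text \<open>An identity of measures, from which the change of variables for integrals, for
  integrability and for almost-everywhere statements can all be read off.\<close>

lemma density_Cw:
  assumes a: "a \<in> {0, 2}"
  shows "density M (\<lambda>x. ennreal (indicator (Cw [a]) x)) = density (distr M borel (Smap a)) (\<lambda>_. ennreal (w a))"
proof (rule measure_eqI)
  fix A assume "A \<in> sets (density M (\<lambda>x. ennreal (indicator (Cw [a]) x)))"
  then have [measurable]: "A \<in> sets borel" by simp
  have "emeasure (density M (\<lambda>x. ennreal (indicator (Cw [a]) x))) A = emeasure M (Cw [a] \<inter> A)"
    by (simp add: emeasure_density ennreal_indicator flip: indicator_inter_arith)
  then show "emeasure (density M (\<lambda>x. ennreal (indicator (Cw [a]) x))) A =
      emeasure (density (distr M borel (Smap a)) (\<lambda>_. ennreal (w a))) A"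
    using a by (simp add: emeasure_Int_Cw emeasure_density nn_integral_cmult emeasure_distr)
qed simp

context
  fixes f :: "real \<Rightarrow> 'b::{banach, second_countable_topology}" and a :: nat
  assumes a: "a \<in> {0, 2}" and f: "f \<in> borel_measurable borel"
begin

lemma integral_Cw: "(\<integral>x. indicator (Cw [a]) x *\<^sub>R f x \<partial>M) = w a *\<^sub>R (\<integral>x. f (Smap a x) \<partial>M)"
proof -
  have "(\<integral>x. indicator (Cw [a]) x *\<^sub>R f x \<partial>M) = integral\<^sup>L (density M (\<lambda>x. ennreal (indicator (Cw [a]) x))) f"
    using f by (subst integral_density) auto
  also have "\<dots> = w a *\<^sub>R (\<integral>x. f (Smap a x) \<partial>M)"
    using f w_pos[of a] by (subst density_Cw[OF a], subst integral_density) (auto simp: integral_distr)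
  finally show ?thesis .
qed

lemma integrable_Cw: "integrable M (\<lambda>x. indicator (Cw [a]) x *\<^sub>R f x) \<longleftrightarrow> integrable M (\<lambda>x. f (Smap a x))"
proof -
  have "integrable M (\<lambda>x. indicator (Cw [a]) x *\<^sub>R f x) \<longleftrightarrow> integrable (density M (\<lambda>x. ennreal (indicator (Cw [a]) x))) f"
    using f by (subst integrable_density) auto
  also have "\<dots> \<longleftrightarrow> integrable M (\<lambda>x. w a *\<^sub>R f (Smap a x))"
    using f w_pos[of a] by (subst density_Cw[OF a], subst integrable_density) (simp_all add: integrable_distr_eq)
  also have "\<dots> \<longleftrightarrow> integrable M (\<lambda>x. f (Smap a x))"
    using w_pos[of a] integrable_scaleR_right[of "1 / w a" M "\<lambda>x. w a *\<^sub>R f (Smap a x)"] by auto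
  finally show ?thesis .
qed

end

lemma AE_Cw:
  assumes a: "a \<in> {0, 2}"
  shows "(AE x in M. x \<in> Cw [a] \<longrightarrow> P x) \<longleftrightarrow> (AE x in distr M borel (Smap a). P x)"
proof -
  have "(AE x in M. x \<in> Cw [a] \<longrightarrow> P x) \<longleftrightarrow> (AE x in density M (\<lambda>x. ennreal (indicator (Cw [a]) x)). P x)"
    by (subst AE_density) (auto simp: indicator_def)
  also have "\<dots> \<longleftrightarrow> (AE x in distr M borel (Smap a). P x)"
    using w_pos[of a] by (subst density_Cw[OF a], subst AE_density) auto
  finally show ?thesis .
qed

lemma AE_Smap:
  assumes "a \<in> {0, 2}" "AE x in M. P x" shows "AE x in M. P (Smap a x)"
proof -
  have "AE x in distr M borel (Smap a). P x"
    unfolding AE_Cw[OF assms(1), symmetric] by (rule eventually_mono[OF assms(2)]) simp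
  then show ?thesis by (rule AE_distrD[rotated]) simp
qed

lemma AE_Smap_inverse:
  assumes a: "a \<in> {0, 2}" and P: "AE x in M. P x"
  shows "AE x in M. x \<in> Cw [a] \<longrightarrow> P (3 * x - real a)"
proof -
  \<comment> \<open>\<open>P\<close> may fail to be measurable, while \<open>AE_distr_iff\<close>
    asks for a measurable predicate. A measurable null set containing the exceptions is transported
    instead.\<close>
  obtain N where N: "N \<in> null_sets M" "{x. \<not> P x} \<subseteq> N"
    using P by (auto simp: eventually_ae_filter)
  then have [measurable]: "N \<in> sets borel" by auto
  have "AE x in M. x \<notin> N" using AE_not_in N(1) .
  then have "AE x in M. 3 * Smap a x - real a \<notin> N" using a by (simp add: Smap_alt add_divide_distrib)
  then have "AE x in distr M borel (Smap a). 3 * x - real a \<notin> N" by (subst AE_distr_iff) auto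
  then have "AE x in M. x \<in> Cw [a] \<longrightarrow> 3 * x - real a \<notin> N" using a by (subst AE_Cw)
  then show ?thesis by eventually_elim (use N in auto)
qed

lemma AE_Cw_cases: "AE x in M. x \<in> Cw [0] \<or> x \<in> Cw [2]"
proof -
  have e: "emeasure M (Cw [a]) = ennreal (w a)" if "a \<in> {0, 2}" for a
    using emeasure_Int_Cw[OF that, of UNIV] emeasure_space_1 by simp
  have "emeasure M (Cw [0] \<union> Cw [2]) = ennreal (w 0) + ennreal (w 2)"
    by (subst plus_emeasure[symmetric]) (simp_all add: Cw_0_2_disjoint e)
  also have "\<dots> = 1"
    using p_pos p_less by (subst ennreal_plus[symmetric]) (auto simp: w_def)
  finally have "prob (Cw [0] \<union> Cw [2]) = 1" by (simp add: measure_def)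
  then show ?thesis by (subst (asm) prob_eq_1) auto
qed

lemma integral_split:
  fixes f :: "real \<Rightarrow> 'b::{banach, second_countable_topology}"
  assumes f: "integrable M f"
  shows "integral\<^sup>L M f = w 0 *\<^sub>R (\<integral>x. f (Smap 0 x) \<partial>M) + w 2 *\<^sub>R (\<integral>x. f (Smap 2 x) \<partial>M)"
proof -
  have [measurable]: "f \<in> borel_measurable borel" using borel_measurable_integrable[OF f] by simp
  have i: "integrable M (\<lambda>x. indicator (Cw [a]) x *\<^sub>R f x)" for a
    by (intro integrable_mult_indicator f) simp
  have "integral\<^sup>L M f = (\<integral>x. indicator (Cw [0]) x *\<^sub>R f x + indicator (Cw [2]) x *\<^sub>R f x \<partial>M)"
    by (intro integral_cong_AE eventually_mono[OF AE_Cw_cases])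
       (use Cw_0_2_disjoint in \<open>auto simp: indicator_def\<close>)
  then show ?thesis using i by (simp add: integral_Cw)
qed

end

section \<open>Square-integrable functions and bounded operators\<close>

lemma L2norm_power2: "(L2norm M f)\<^sup>2 = (\<integral>x. (cmod (f x))\<^sup>2 \<partial>M)"
  by (simp add: L2norm_def)

lemma L2norm_nonneg: "0 \<le> L2norm M f"
  by (simp add: L2norm_def)

lemma L2_measurable: "f \<in> L2 M \<Longrightarrow> f \<in> borel_measurable M"
  by (simp add: L2_def)

lemma L2_integrable: "f \<in> L2 M \<Longrightarrow> integrable M (\<lambda>x. (cmod (f x))\<^sup>2)"
  by (simp add: L2_def)

lemma L2_cmult: "f \<in> L2 M \<Longrightarrow> (\<lambda>x. c * f x) \<in> L2 M"
  by (auto simp: L2_def norm_mult power_mult_distrib)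

lemma cmod_add_power2_le: "(cmod (a + b))\<^sup>2 \<le> 2 * (cmod a)\<^sup>2 + 2 * (cmod b)\<^sup>2"
proof -
  have "(cmod (a + b))\<^sup>2 \<le> (cmod a + cmod b)\<^sup>2"
    by (intro power_mono norm_triangle_ineq) auto
  also have "\<dots> \<le> 2 * (cmod a)\<^sup>2 + 2 * (cmod b)\<^sup>2"
    using zero_le_power2[of "cmod a - cmod b"] unfolding power2_sum power2_diff by linarith
  finally show ?thesis .
qed

lemma L2_add:
  assumes "f \<in> L2 M" "g \<in> L2 M" shows "(\<lambda>x. f x + g x) \<in> L2 M"
proof -
  have [measurable]: "f \<in> borel_measurable M" "g \<in> borel_measurable M"
    using assms by (auto simp: L2_def)
  have "integrable M (\<lambda>x. (cmod (f x + g x))\<^sup>2)"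
    by (rule Bochner_Integration.integrable_bound[where f="\<lambda>x. 2 * (cmod (f x))\<^sup>2 + 2 * (cmod (g x))\<^sup>2"])
       (use assms in \<open>auto simp: L2_def intro!: cmod_add_power2_le AE_I2\<close>)
  then show ?thesis by (simp add: L2_def)
qed

lemma L2_diff: "f \<in> L2 M \<Longrightarrow> g \<in> L2 M \<Longrightarrow> (\<lambda>x. f x - g x) \<in> L2 M"
  using L2_add[of f M "\<lambda>x. (-1) * g x"] L2_cmult[of g M "-1"] by simp

text \<open>A weak substitute for the Minkowski inequality. The factor 2 is harmless: the version
  for differences serves only to get some bound, or to show that a quantity tends to 0.\<close>

lemma L2norm_add_power2_le:
  assumes "f \<in> L2 M" "g \<in> L2 M"
  shows "(L2norm M (\<lambda>x. f x + g x))\<^sup>2 \<le> 2 * (L2norm M f)\<^sup>2 + 2 * (L2norm M g)\<^sup>2"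
proof -
  have "(L2norm M (\<lambda>x. f x + g x))\<^sup>2 \<le> (\<integral>x. 2 * (cmod (f x))\<^sup>2 + 2 * (cmod (g x))\<^sup>2 \<partial>M)"
    unfolding L2norm_power2
    by (intro integral_mono L2_integrable[OF L2_add[OF assms]] cmod_add_power2_le)
       (use assms in \<open>auto simp: L2_def\<close>)
  then show ?thesis using assms by (simp add: L2norm_power2 L2_def)
qed

lemma L2norm_cmult: "L2norm M (\<lambda>x. c * f x) = cmod c * L2norm M f"
  by (simp add: L2norm_def norm_mult power_mult_distrib real_sqrt_mult)

lemma L2norm_minus: "L2norm M (\<lambda>x. - f x) = L2norm M f"
  by (simp add: L2norm_def)

lemma L2norm_diff_power2_le:
  assumes "f \<in> L2 M" "g \<in> L2 M"
  shows "(L2norm M (\<lambda>x. f x - g x))\<^sup>2 \<le> 2 * (L2norm M f)\<^sup>2 + 2 * (L2norm M g)\<^sup>2"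
  using L2norm_add_power2_le[of f M "\<lambda>x. (-1) * g x"] L2_cmult[of g M "-1"] assms
  by (simp add: L2norm_minus)

lemma L2norm_cong_AE:
  assumes "AE x in M. f x = g x" "f \<in> borel_measurable M" "g \<in> borel_measurable M"
  shows "L2norm M f = L2norm M g"
  unfolding L2norm_def using assms by (intro arg_cong[where f=sqrt] integral_cong_AE) auto

lemma L2norm_eq_0_iff:
  assumes "f \<in> L2 M" shows "L2norm M f = 0 \<longleftrightarrow> (AE x in M. f x = 0)"
  using integral_nonneg_eq_0_iff_AE[OF L2_integrable[OF assms]] by (simp add: L2norm_def)

lemma borel_measurable_cnj [measurable (raw)]:
  "f \<in> borel_measurable M \<Longrightarrow> (\<lambda>x. cnj (f x)) \<in> borel_measurable M"
  by (intro borel_measurable_continuous_on[where f=cnj] continuous_intros)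

lemma L2_inner_integrable:
  assumes "f \<in> L2 M" "g \<in> L2 M" shows "integrable M (\<lambda>x. cnj (f x) * g x)"
proof (rule Bochner_Integration.integrable_bound[where f="\<lambda>x. (cmod (f x))\<^sup>2 + (cmod (g x))\<^sup>2"])
  have "cmod (f x) * cmod (g x) \<le> (cmod (f x))\<^sup>2 + (cmod (g x))\<^sup>2" for x
    using sum_squares_bound[of "cmod (f x)" "cmod (g x)"]
      mult_nonneg_nonneg[OF norm_ge_zero[of "f x"] norm_ge_zero[of "g x"]] by linarith
  then show "AE x in M. norm (cnj (f x) * g x) \<le> norm ((cmod (f x))\<^sup>2 + (cmod (g x))\<^sup>2)"
    by (auto simp: norm_mult)
qed (use assms in \<open>auto simp: L2_def\<close>)

lemma L2inner_linear:
  assumes "f \<in> L2 M" "g \<in> L2 M" "h \<in> L2 M"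
  shows "L2inner M f (\<lambda>x. a * g x + b * h x) = a * L2inner M f g + b * L2inner M f h"
proof -
  have "L2inner M f (\<lambda>x. a * g x + b * h x) = (\<integral>x. a * (cnj (f x) * g x) + b * (cnj (f x) * h x) \<partial>M)"
    by (simp add: L2inner_def algebra_simps)
  also have "\<dots> = a * L2inner M f g + b * L2inner M f h"
    unfolding L2inner_def using L2_inner_integrable assms by simp
  finally show ?thesis .
qed

lemma L2inner_self: "L2inner M f f = complex_of_real ((L2norm M f)\<^sup>2)"
  unfolding L2inner_def L2norm_power2
  by (subst integral_complex_of_real[symmetric]) (simp add: complex_norm_square[symmetric] mult.commute)

lemma L2inner_cong_AE:
  assumes "f \<in> L2 M" "g \<in> L2 M" "h \<in> L2 M" "AE x in M. g x = h x"
  shows "L2inner M f g = L2inner M f h"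
  unfolding L2inner_def using assms by (intro integral_cong_AE) (auto simp: L2_def)

section \<open>Estimates on a probability space\<close>

context real_distribution
begin

lemma L2_bounded:
  assumes "f \<in> borel_measurable M" "\<And>x. cmod (f x) \<le> c"
  shows "f \<in> L2 M"
proof -
  have "integrable M (\<lambda>x. (cmod (f x))\<^sup>2)"
    by (rule integrable_const_bound[where B="c\<^sup>2"]) (use assms in \<open>auto intro!: power_mono AE_I2\<close>)
  then show ?thesis using assms by (simp add: L2_def)
qed

lemma L2norm_le_bound:
  assumes "f \<in> borel_measurable M" "\<And>x. cmod (f x) \<le> c"
  shows "L2norm M f \<le> c"
proof -
  have c: "0 \<le> c" using order_trans[OF norm_ge_zero assms(2)] .
  have "(\<integral>x. (cmod (f x))\<^sup>2 \<partial>M) \<le> c\<^sup>2"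
    using L2_integrable[OF L2_bounded[OF assms]]
    by (intro integral_le_const) (auto intro!: power_mono assms AE_I2)
  then show ?thesis using c by (simp add: L2norm_def real_le_lsqrt)
qed

lemma L2_indicator: "A \<in> sets M \<Longrightarrow> indicator A \<in> L2 M"
  by (rule L2_bounded[where c=1]) (auto simp: indicator_def)

text \<open>Cauchy-Schwarz in the one case required: the indicator is at most 1 and the total mass
  is 1.\<close>

lemma L2inner_indicator_le:
  assumes A: "A \<in> sets M" and f: "f \<in> L2 M"
  shows "cmod (L2inner M (indicator A) f) \<le> L2norm M f"
proof -
  have [measurable]: "f \<in> borel_measurable M" using f by (rule L2_measurable)
  have "integrable M (\<lambda>x. 1 + (cmod (f x))\<^sup>2)" using L2_integrable[OF f] by simp
  moreover have "cmod (f x) \<le> 1 + (cmod (f x))\<^sup>2" for x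
    using sum_squares_bound[of 1 "cmod (f x)"] norm_ge_zero[of "f x"] unfolding power_one mult_1_right by linarith
  ultimately have i: "integrable M (\<lambda>x. cmod (f x))"
    by (intro Bochner_Integration.integrable_bound[where g="\<lambda>x. cmod (f x)"]) auto
  have "cmod (L2inner M (indicator A) f) \<le> (\<integral>x. cmod (cnj (indicator A x) * f x) \<partial>M)"
    unfolding L2inner_def by (rule integral_norm_bound)
  also have "\<dots> \<le> (\<integral>x. cmod (f x) \<partial>M)"
    by (intro integral_mono integrable_norm L2_inner_integrable L2_indicator A f i) (auto simp: indicator_def)
  also have "\<dots> \<le> L2norm M f"
  proof -
    \<comment> \<open>Nonnegative variance of \<open>cmod (f x)\<close> says that the squared mean
      is at most the mean of the square.\<close>
    have "0 \<le> variance (\<lambda>x. cmod (f x))" by (rule variance_positive)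
    then have "(\<integral>x. cmod (f x) \<partial>M)\<^sup>2 \<le> (\<integral>x. (cmod (f x))\<^sup>2 \<partial>M)"
      using variance_eq[OF i L2_integrable[OF f]] by simp
    then show ?thesis unfolding L2norm_def by (rule real_le_rsqrt)
  qed
  finally show ?thesis .
qed

end

section \<open>Bounded operators and the operator distance\<close>

lemma bdd_opD:
  assumes "bdd_op M T" "f \<in> L2 M"
  shows "T f \<in> L2 M"
    and "g \<in> L2 M \<Longrightarrow> AE x in M. f x = g x \<Longrightarrow> AE x in M. T f x = T g x"
    and "AE x in M. T (\<lambda>y. c * f y) x = c * T f x"
proof -
  show "T f \<in> L2 M" and "g \<in> L2 M \<Longrightarrow> AE x in M. f x = g x \<Longrightarrow> AE x in M. T f x = T g x"
    using assms by (auto simp: bdd_op_def)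
  have "AE x in M. T (\<lambda>y. c * f y + 0 * f y) x = c * T f x + 0 * T f x"
    using assms unfolding bdd_op_def by blast
  then show "AE x in M. T (\<lambda>y. c * f y) x = c * T f x" by simp
qed

text \<open>The constant in \<open>bdd_op\<close> may be negative when all norms vanish; a
  nonnegative one can be squared and multiplied safely.\<close>

lemma bdd_op_bound:
  assumes "bdd_op M T"
  obtains C where "0 \<le> C" "\<And>f. f \<in> L2 M \<Longrightarrow> L2norm M (T f) \<le> C * L2norm M f"
proof -
  obtain C where C: "\<And>f. f \<in> L2 M \<Longrightarrow> L2norm M (T f) \<le> C * L2norm M f"
    using assms unfolding bdd_op_def by blast
  have "L2norm M (T f) \<le> max C 0 * L2norm M f" if "f \<in> L2 M" for f
    using C[OF that] mult_right_mono[of C "max C 0" "L2norm M f"] L2norm_nonneg[of M f] by simp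
  then show thesis by (intro that[of "max C 0"]) auto
qed

lemma bdd_op_diff_bound:
  assumes T: "bdd_op M T" and S: "bdd_op M S"
  obtains C where "0 \<le> C" "\<And>f. f \<in> L2 M \<Longrightarrow> (L2norm M (\<lambda>x. T f x - S f x))\<^sup>2 \<le> C * (L2norm M f)\<^sup>2"
proof -
  obtain C where C: "0 \<le> C" "\<And>f. f \<in> L2 M \<Longrightarrow> L2norm M (T f) \<le> C * L2norm M f"
    using bdd_op_bound[OF T] by blast
  obtain D where D: "0 \<le> D" "\<And>f. f \<in> L2 M \<Longrightarrow> L2norm M (S f) \<le> D * L2norm M f"
    using bdd_op_bound[OF S] by blast
  show thesis
  proof (rule that[of "2 * C\<^sup>2 + 2 * D\<^sup>2"])
    fix f assume f: "f \<in> L2 M"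
    have "(L2norm M (\<lambda>x. T f x - S f x))\<^sup>2 \<le> 2 * (L2norm M (T f))\<^sup>2 + 2 * (L2norm M (S f))\<^sup>2"
      by (intro L2norm_diff_power2_le bdd_opD[OF T f] bdd_opD[OF S f])
    also have "\<dots> \<le> 2 * (C * L2norm M f)\<^sup>2 + 2 * (D * L2norm M f)\<^sup>2"
      by (intro add_mono mult_left_mono power_mono C D f L2norm_nonneg) auto
    finally show "(L2norm M (\<lambda>x. T f x - S f x))\<^sup>2 \<le> (2 * C\<^sup>2 + 2 * D\<^sup>2) * (L2norm M f)\<^sup>2"
      by (simp add: power_mult_distrib algebra_simps)
  qed simp
qed

text \<open>A real \<open>Sup\<close> says something only for a set bounded above. Boundedness of
  both operators supplies the bound \<open>sqrt C\<close> on the unit ball.\<close>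

lemma op_dist_upper:
  assumes T: "bdd_op M T" and S: "bdd_op M S" and f: "f \<in> L2 M" "L2norm M f \<le> 1"
  shows "L2norm M (\<lambda>x. T f x - S f x) \<le> op_dist M T S"
proof -
  obtain C where C: "0 \<le> C" "\<And>f. f \<in> L2 M \<Longrightarrow> (L2norm M (\<lambda>x. T f x - S f x))\<^sup>2 \<le> C * (L2norm M f)\<^sup>2"
    using bdd_op_diff_bound[OF T S] by blast
  have "L2norm M (\<lambda>x. T g x - S g x) \<le> sqrt C" if g: "g \<in> L2 M" "L2norm M g \<le> 1" for g
  proof (rule real_le_rsqrt)
    have "(L2norm M g)\<^sup>2 \<le> 1" using g L2norm_nonneg[of M g] by (simp add: power_le_one)
    then have "C * (L2norm M g)\<^sup>2 \<le> C" using C(1) by (simp add: mult_left_le)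
    then show "(L2norm M (\<lambda>x. T g x - S g x))\<^sup>2 \<le> C" using C(2)[OF g(1)] by simp
  qed
  then have "bdd_above {L2norm M (\<lambda>x. T f x - S f x) | f. f \<in> L2 M \<and> L2norm M f \<le> 1}"
    by (intro bdd_aboveI[of _ "sqrt C"]) auto
  then show ?thesis unfolding op_dist_def by (intro cSup_upper) (use f in auto)
qed

lemma op_dist_bound:
  assumes T: "bdd_op M T" and S: "bdd_op M S" and f: "f \<in> L2 M"
  shows "L2norm M (\<lambda>x. T f x - S f x) \<le> op_dist M T S * L2norm M f"
proof (cases "L2norm M f = 0")
  \<comment> \<open>Normalising \<open>f\<close> is impossible here; the bound on the difference
    forces the left side to be 0.\<close>
  case True
  obtain C where "\<And>f. f \<in> L2 M \<Longrightarrow> (L2norm M (\<lambda>x. T f x - S f x))\<^sup>2 \<le> C * (L2norm M f)\<^sup>2"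
    using bdd_op_diff_bound[OF T S] by blast
  from this[OF f] show ?thesis using True by simp
next
  case False
  define c where "c = L2norm M f"
  have c: "0 < c" using False L2norm_nonneg[of M f] by (simp add: c_def)
  define g where "g = (\<lambda>x. complex_of_real (1 / c) * f x)"
  have g: "g \<in> L2 M" unfolding g_def by (rule L2_cmult[OF f])
  have "L2norm M g = 1" unfolding g_def L2norm_cmult norm_of_real c_def[symmetric] using c by simp
  then have "L2norm M (\<lambda>x. T g x - S g x) \<le> op_dist M T S"
    by (intro op_dist_upper T S g) simp
  \<comment> \<open>Operators are homogeneous only almost everywhere, so the scalar is pulled out
    under the norm and not pointwise.\<close>
  also have "L2norm M (\<lambda>x. T g x - S g x) = L2norm M (\<lambda>x. complex_of_real (1 / c) * (T f x - S f x))"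
  proof (rule L2norm_cong_AE)
    show "AE x in M. T g x - S g x = complex_of_real (1 / c) * (T f x - S f x)"
      using bdd_opD(3)[OF T f, of "complex_of_real (1 / c)"] bdd_opD(3)[OF S f, of "complex_of_real (1 / c)"]
      unfolding g_def by eventually_elim (simp only: right_diff_distrib)
  qed (intro L2_measurable L2_diff L2_cmult bdd_opD(1)[OF T] bdd_opD(1)[OF S] f g)+
  also have "\<dots> = L2norm M (\<lambda>x. T f x - S f x) / c"
    unfolding L2norm_cmult norm_of_real using c by simp
  finally show ?thesis using c by (simp add: c_def pos_divide_le_eq)
qed

section \<open>The isometries and the partial sums\<close>

lemma finite_words_upto: "finite (words_upto m)"
  unfolding words_upto_def by (rule finite_lists_length_le) simp

lemma words_upto_Suc:
  "words_upto (Suc m) = insert [] ((#) 0 ` words_upto m \<union> (#) 2 ` words_upto m)" (is "?L = ?R")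
proof
  show "?L \<subseteq> ?R"
  proof
    fix u assume "u \<in> ?L"
    then show "u \<in> ?R" by (cases u) (auto simp: words_upto_def)
  qed
qed (auto simp: words_upto_def)

lemma sum_words_upto_Suc:
  "sum g (words_upto (Suc m)) =
     g [] + (\<Sum>u\<in>words_upto m. g (0 # u)) + (\<Sum>u\<in>words_upto m. g (2 # u))"
proof -
  have "sum g (words_upto (Suc m)) = g [] + sum g ((#) 0 ` words_upto m \<union> (#) 2 ` words_upto m)"
    unfolding words_upto_Suc using finite_words_upto by (subst sum.insert) auto
  also have "sum g ((#) 0 ` words_upto m \<union> (#) 2 ` words_upto m) =
      sum g ((#) 0 ` words_upto m) + sum g ((#) 2 ` words_upto m)"
    using finite_words_upto by (intro sum.union_disjoint) auto
  finally show ?thesis by (simp add: sum.reindex add.assoc)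
qed

context cantor_measure
begin

definition U :: "nat \<Rightarrow> op" where
  "U a f = (\<lambda>x. complex_of_real (w a powr (-1/2)) * indicator (Cw [a]) x * f (3 * x - real a))"

text \<open>The explicit adjoint of \<open>U a\<close>, defined at every point, in contrast to the
  choice made by \<open>adjoint\<close>.\<close>

definition V :: "nat \<Rightarrow> op" where
  "V a f = (\<lambda>x. complex_of_real (sqrt (w a)) * f (Smap a x))"

lemma U0_eq: "U0 p = U 0" and U2_eq: "U2 p = U 2"
  by (auto simp: U0_def U2_def U_def w_def S0inv_def S2inv_def fun_eq_iff)

lemma U_alt: "U a f x = complex_of_real (1 / sqrt (w a)) * indicator (Cw [a]) x * f (3 * x - real a)"
  using w_pos[of a] by (simp add: U_def powr_minus_divide powr_half_sqrt)

lemma U_coeff_mult: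
  "complex_of_real (w a) * complex_of_real (1 / sqrt (w a)) = complex_of_real (sqrt (w a))"
  "complex_of_real (sqrt (w a)) * complex_of_real (1 / sqrt (w a)) = 1"
  unfolding of_real_mult[symmetric] using w_pos[of a] by (simp_all add: real_div_sqrt)

lemma L2_borel: "f \<in> L2 M \<Longrightarrow> f \<in> borel_measurable borel"
  using L2_measurable[of f M] by simp

text \<open>Squaring the coefficient of \<open>U a\<close> gives \<open>1 / w a\<close>, which
  cancels the weight \<open>w a\<close> in the change of variables; hence \<open>U a\<close> is an
  isometry.\<close>

lemma U_L2:
  assumes a: "a \<in> {0, 2}" and f: "f \<in> L2 M"
  shows "U a f \<in> L2 M" and "(L2norm M (U a f))\<^sup>2 = (L2norm M f)\<^sup>2"
proof -
  have [measurable]: "f \<in> borel_measurable borel" using f by (rule L2_borel)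
  define g where "g x = (1 / w a) * (cmod (f (3 * x - real a)))\<^sup>2" for x
  have [measurable]: "g \<in> borel_measurable borel" unfolding g_def by measurable
  have sq: "(cmod (U a f x))\<^sup>2 = indicator (Cw [a]) x *\<^sub>R g x" for x
    using w_pos[of a] by (auto simp: U_alt g_def norm_mult norm_divide power_mult_distrib power_divide indicator_def)
  have gS: "g (Smap a x) = (1 / w a) * (cmod (f x))\<^sup>2" for x
    using a by (simp add: g_def Smap_alt add_divide_distrib)
  have "integrable M (\<lambda>x. g (Smap a x))"
    unfolding gS using L2_integrable[OF f] by simp
  then have "integrable M (\<lambda>x. (cmod (U a f x))\<^sup>2)"
    unfolding sq by (subst integrable_Cw[OF a]) simp_all
  moreover have "U a f \<in> borel_measurable borel" unfolding U_def by measurable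
  ultimately show "U a f \<in> L2 M" by (simp add: L2_def)
  show "(L2norm M (U a f))\<^sup>2 = (L2norm M f)\<^sup>2"
    unfolding L2norm_power2 sq using w_pos[of a]
    by (subst integral_Cw[OF a]) (simp_all add: gS)
qed

lemma V_L2:
  assumes a: "a \<in> {0, 2}" and f: "f \<in> L2 M"
  shows "V a f \<in> L2 M"
proof -
  have [measurable]: "f \<in> borel_measurable borel" using f by (rule L2_borel)
  have "integrable M (\<lambda>x. indicator (Cw [a]) x *\<^sub>R (cmod (f x))\<^sup>2)"
    by (intro integrable_mult_indicator L2_integrable f) simp
  then have "integrable M (\<lambda>x. (cmod (f (Smap a x)))\<^sup>2)"
    by (subst (asm) integrable_Cw[OF a]) simp_all
  then have "integrable M (\<lambda>x. (cmod (V a f x))\<^sup>2)"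
    by (simp add: V_def norm_mult power_mult_distrib)
  moreover have "V a f \<in> borel_measurable borel" unfolding V_def by measurable
  ultimately show ?thesis by (simp add: L2_def)
qed

text \<open>The squared coefficient of \<open>V a\<close> is exactly the weight of its branch in
  \<open>integral_split\<close>.\<close>

lemma V_norm_sum:
  assumes f: "f \<in> L2 M"
  shows "(L2norm M (V 0 f))\<^sup>2 + (L2norm M (V 2 f))\<^sup>2 = (L2norm M f)\<^sup>2"
proof -
  have "(L2norm M (V a f))\<^sup>2 = w a * (\<integral>x. (cmod (f (Smap a x)))\<^sup>2 \<partial>M)" for a
    using w_pos[of a] by (simp add: L2norm_power2 V_def norm_mult power_mult_distrib)
  then show ?thesis
    unfolding L2norm_power2[of M f] integral_split[OF L2_integrable[OF f]] by simp
qed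

lemma V_norm_le:
  assumes a: "a \<in> {0, 2}" and f: "f \<in> L2 M"
  shows "L2norm M (V a f) \<le> L2norm M f"
proof (rule power2_le_imp_le)
  have "0 \<le> (L2norm M (V 0 f))\<^sup>2" "0 \<le> (L2norm M (V 2 f))\<^sup>2" by simp_all
  then show "(L2norm M (V a f))\<^sup>2 \<le> (L2norm M f)\<^sup>2"
    unfolding V_norm_sum[OF f, symmetric] using a by auto
qed (rule L2norm_nonneg)

lemma V_bdd_op:
  assumes a: "a \<in> {0, 2}" shows "bdd_op M (V a)"
  unfolding bdd_op_def
proof (intro conjI ballI impI allI)
  fix f g :: "real \<Rightarrow> complex" assume "AE x in M. f x = g x"
  from AE_Smap[OF a this] show "AE x in M. V a f x = V a g x"
    by eventually_elim (simp add: V_def)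
next
  show "\<exists>C. \<forall>f\<in>L2 M. L2norm M (V a f) \<le> C * L2norm M f"
    using V_norm_le[OF a] by (intro exI[of _ 1]) simp
qed (use V_L2[OF a] in \<open>simp_all add: V_def algebra_simps\<close>)

lemma U_V_adjoint:
  assumes a: "a \<in> {0, 2}" and f: "f \<in> L2 M" and g: "g \<in> L2 M"
  shows "L2inner M (U a f) g = L2inner M f (V a g)"
proof -
  have [measurable]: "f \<in> borel_measurable borel" "g \<in> borel_measurable borel"
    using f g L2_borel by auto
  define h where "h x = complex_of_real (1 / sqrt (w a)) * (cnj (f (3 * x - real a)) * g x)" for x
  have [measurable]: "h \<in> borel_measurable borel" unfolding h_def by measurable
  have "L2inner M (U a f) g = (\<integral>x. indicator (Cw [a]) x *\<^sub>R h x \<partial>M)"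
    unfolding L2inner_def
    by (intro Bochner_Integration.integral_cong) (auto simp: U_alt h_def indicator_def)
  also have "\<dots> = w a *\<^sub>R (\<integral>x. h (Smap a x) \<partial>M)"
    by (rule integral_Cw[OF a]) simp
  also have "\<dots> = (\<integral>x. w a *\<^sub>R h (Smap a x) \<partial>M)" by simp
  also have "\<dots> = L2inner M f (V a g)"
  proof -
    have "w a *\<^sub>R h (Smap a x) =
        (complex_of_real (w a) * complex_of_real (1 / sqrt (w a))) * (cnj (f x) * g (Smap a x))" for x
      using a by (simp add: h_def Smap_alt add_divide_distrib scaleR_conv_of_real)
    then have "w a *\<^sub>R h (Smap a x) = cnj (f x) * V a g x" for x
      unfolding U_coeff_mult V_def by (simp only: mult_ac)
    then show ?thesis by (simp add: L2inner_def)
  qed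
  finally show ?thesis .
qed

text \<open>\<open>V a\<close> shows that the choice in \<open>adjoint\<close> has a witness. For
  the chosen operator \<open>W\<close>, the difference \<open>h\<close> of \<open>W f\<close> and
  \<open>V a f\<close> is orthogonal to itself, hence null.\<close>

lemma adjoint_U:
  assumes a: "a \<in> {0, 2}"
  shows "f \<in> L2 M \<Longrightarrow> adjoint M (U a) f \<in> L2 M"
    and "f \<in> L2 M \<Longrightarrow> AE x in M. adjoint M (U a) f x = V a f x"
proof -
  define W where "W = adjoint M (U a)"
  have "bdd_op M W \<and> (\<forall>f \<in> L2 M. \<forall>g \<in> L2 M. L2inner M (U a f) g = L2inner M f (W g))"
    unfolding W_def adjoint_def
    by (rule someI[of _ "V a"]) (use V_bdd_op[OF a] U_V_adjoint[OF a] in blast)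
  then have W: "bdd_op M W" "\<And>f g. f \<in> L2 M \<Longrightarrow> g \<in> L2 M \<Longrightarrow> L2inner M (U a f) g = L2inner M f (W g)"
    by auto
  show 1: "adjoint M (U a) f \<in> L2 M" if "f \<in> L2 M" for f
    using bdd_opD(1)[OF W(1) that] by (simp add: W_def)
  show "AE x in M. adjoint M (U a) f x = V a f x" if f: "f \<in> L2 M"
  proof -
    have Wf: "W f \<in> L2 M" using 1[OF f] by (simp add: W_def)
    define h where "h = (\<lambda>x. 1 * W f x + (- 1) * V a f x)"
    have h: "h \<in> L2 M"
      unfolding h_def by (intro L2_add L2_cmult Wf V_L2[OF a f])
    have "L2inner M h h = 1 * L2inner M h (W f) + (- 1) * L2inner M h (V a f)"
      by (subst (2) h_def, rule L2inner_linear) (intro h Wf V_L2[OF a f])+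
    also have "\<dots> = 0" using W(2)[OF h f] U_V_adjoint[OF a h f] by simp
    finally have "L2norm M h = 0" unfolding L2inner_self by simp
    then have "AE x in M. h x = 0" using h by (simp add: L2norm_eq_0_iff)
    then show ?thesis by eventually_elim (simp add: h_def W_def)
  qed
qed

lemma U_cong_AE:
  assumes a: "a \<in> {0, 2}" and "AE x in M. f x = g x"
  shows "AE x in M. U a f x = U a g x"
  using AE_Smap_inverse[OF assms] by eventually_elim (auto simp: U_def indicator_def)

section \<open>A pointwise version of \<open>Psi\<close> and its action on the partial sums\<close>

definition Phi :: "op \<Rightarrow> op" where
  "Phi T f = (\<lambda>x. Pphi p f x + (complex_of_real (w 0) * U 0 (T (V 0 f)) x + complex_of_real (w 2) * U 2 (T (V 2 f)) x))"

text \<open>The chosen adjoint agrees with \<open>V a\<close> only almost everywhere, so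
  \<open>T\<close> must respect almost-everywhere equality. \<open>Phi\<close> can then be computed
  at every single point.\<close>

lemma Psi_eq_Phi:
  assumes f: "f \<in> L2 M"
    and T: "\<And>g h. g \<in> L2 M \<Longrightarrow> h \<in> L2 M \<Longrightarrow> AE x in M. g x = h x \<Longrightarrow> AE x in M. T g x = T h x"
  shows "AE x in M. Psi p T f x = Phi T f x"
proof -
  have *: "AE x in M. U a (T (adjoint M (U a) f)) x = U a (T (V a f)) x" if a: "a \<in> {0, 2}" for a
    by (intro U_cong_AE T adjoint_U V_L2 a f)
  show ?thesis
    using *[of 0, simplified] *[of 2, simplified]
    by eventually_elim (simp add: Psi_def Phi_def U0_eq U2_eq w_02 add.assoc)
qed

lemma Psi_cong:
  assumes "op_eq M T S" shows "op_eq M (Psi p T) (Psi p S)"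
  unfolding op_eq_def
proof
  fix f assume f: "f \<in> L2 M"
  have *: "AE x in M. U a (T (adjoint M (U a) f)) x = U a (S (adjoint M (U a) f)) x" if a: "a \<in> {0, 2}" for a
    using assms unfolding op_eq_def by (intro U_cong_AE a) (use adjoint_U(1)[OF a f] in blast)
  show "AE x in M. Psi p T f x = Psi p S f x"
    using *[of 0, simplified] *[of 2, simplified]
    by eventually_elim (simp add: Psi_def U0_eq U2_eq)
qed

lemma Pphi_alt: "Pphi p f x = L2inner M (indicator (Cw [])) f * indicator (Cw []) x"
  by (simp add: Pphi_def phi_def Cw_Nil)

lemma K_0: "K p 0 = Pphi p"
proof -
  have "words_upto 0 = {[]}" by (auto simp: words_upto_def)
  then show ?thesis by (intro ext) (simp only: K_def Pphi_alt sum.insert finite.emptyI sum.empty empty_iff not_False_eq_True add_0_right)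
qed

lemma L2_indicator_Cw: "indicator (Cw u) \<in> L2 M"
  by (rule L2_indicator) simp

text \<open>The indicator of \<open>Cw (a # u)\<close> is \<open>sqrt (w a)\<close> times
  \<open>U a\<close> of the indicator of \<open>Cw u\<close>; the adjoint then moves
  \<open>U a\<close> to the other side.\<close>

lemma L2inner_indicator_Cons:
  assumes a: "a \<in> {0, 2}" and f: "f \<in> L2 M"
  shows "complex_of_real (sqrt (w a)) * L2inner M (indicator (Cw u)) (V a f) = L2inner M (indicator (Cw (a # u))) f"
proof -
  have "indicator (Cw (a # u)) x = complex_of_real (sqrt (w a)) * U a (indicator (Cw u)) x" for x
    unfolding indicator_Cw_Cons[OF a, of u] U_alt mult.assoc[symmetric] U_coeff_mult by simp
  then have "L2inner M (indicator (Cw (a # u))) f =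
      (\<integral>x. complex_of_real (sqrt (w a)) * (cnj (U a (indicator (Cw u)) x) * f x) \<partial>M)"
    unfolding L2inner_def by (intro Bochner_Integration.integral_cong) (auto simp: mult.assoc)
  also have "\<dots> = complex_of_real (sqrt (w a)) * L2inner M (U a (indicator (Cw u))) f"
    by (simp add: L2inner_def)
  finally show ?thesis by (simp add: U_V_adjoint[OF a L2_indicator_Cw f])
qed

text \<open>One branch of \<open>Phi\<close> produces the terms of the words beginning with
  \<open>a\<close>. The weight times the coefficient of \<open>U a\<close> is
  \<open>sqrt (w a)\<close>, just what \<open>L2inner_indicator_Cons\<close> absorbs.\<close>

lemma w_U_K:
  assumes a: "a \<in> {0, 2}" and f: "f \<in> L2 M"
  shows "complex_of_real (w a) * U a (K p m (V a f)) x =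
    (\<Sum>u\<in>words_upto m. L2inner M (indicator (Cw (a # u))) f * indicator (Cw (a # u)) x)"
proof -
  have "complex_of_real (w a) * U a (K p m (V a f)) x = complex_of_real (sqrt (w a)) *
     (indicator (Cw [a]) x * (\<Sum>u\<in>words_upto m. L2inner M (indicator (Cw u)) (V a f) * indicator (Cw u) (3 * x - real a)))"
    unfolding U_alt K_def U_coeff_mult(1)[symmetric] by (simp only: mult.assoc)
  also have "\<dots> = (\<Sum>u\<in>words_upto m. (complex_of_real (sqrt (w a)) * L2inner M (indicator (Cw u)) (V a f)) *
      (indicator (Cw [a]) x * indicator (Cw u) (3 * x - real a)))"
    by (simp add: sum_distrib_left mult_ac)
  finally show ?thesis
    by (simp only: L2inner_indicator_Cons[OF a f] indicator_Cw_Cons[OF a, symmetric])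
qed

lemma K_Suc:
  assumes f: "f \<in> L2 M"
  shows "K p (Suc m) f x = Phi (K p m) f x"
  unfolding Phi_def w_U_K[OF insertI1 f] w_U_K[of 2, simplified, OF f]
  by (simp add: K_def sum_words_upto_Suc Pphi_alt add.assoc)

text \<open>The argument enters \<open>K\<close> only through inner products, so the results are
  equal as functions and not merely almost everywhere.\<close>

lemma K_cong_AE:
  assumes "f \<in> L2 M" "g \<in> L2 M" "AE x in M. f x = g x"
  shows "K p m f = K p m g"
  unfolding K_def using L2inner_cong_AE[OF L2_indicator_Cw assms] by simp

lemma K_Suc_eq_Psi: "op_eq M (K p (Suc m)) (Psi p (K p m))"
  unfolding op_eq_def
proof
  fix f assume f: "f \<in> L2 M"
  have "AE x in M. Psi p (K p m) f x = Phi (K p m) f x"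
  proof (rule Psi_eq_Phi[OF f])
    fix g h assume "g \<in> L2 M" "h \<in> L2 M" "AE x in M. g x = h x"
    then have "K p m g = K p m h" by (rule K_cong_AE)
    then show "AE x in M. K p m g x = K p m h x" by simp
  qed
  then show "AE x in M. K p (Suc m) f x = Psi p (K p m) f x"
    by eventually_elim (simp add: K_Suc[OF f])
qed

lemma K_eq_Psi_power: "op_eq M (K p m) ((Psi p ^^ m) (Pphi p))"
proof (induction m)
  case 0
  show ?case by (simp add: op_eq_def K_0)
next
  case (Suc m)
  show ?case unfolding op_eq_def
  proof
    fix f assume f: "f \<in> L2 M"
    have "AE x in M. K p (Suc m) f x = Psi p (K p m) f x"
      using K_Suc_eq_Psi f unfolding op_eq_def by blast
    moreover have "AE x in M. Psi p (K p m) f x = Psi p ((Psi p ^^ m) (Pphi p)) f x"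
      using Psi_cong[OF Suc] f unfolding op_eq_def by blast
    ultimately show "AE x in M. K p (Suc m) f x = (Psi p ^^ Suc m) (Pphi p) f x"
      by eventually_elim simp
  qed
qed

section \<open>Uniform geometric convergence of the partial sums\<close>

definition r :: real where "r = sqrt (max p (1 - p))"

lemma r_bounds: "0 \<le> r" "r < 1"
  using p_pos p_less by (auto simp: r_def)

lemma sqrt_w_le: "sqrt (w a) \<le> r"
  by (auto simp: w_def r_def)

text \<open>The supports are disjoint, so the larger term is bounded and not the sum. The factor of
  one branch is \<open>w a / sqrt (w a) = sqrt (w a)\<close>, which explains the square root in
  \<open>r\<close>.\<close>

lemma U_sum_bound:
  assumes "\<And>y. cmod (g y) \<le> c" "\<And>y. cmod (h y) \<le> c"
  shows "cmod (complex_of_real (w 0) * U 0 g x + complex_of_real (w 2) * U 2 h x) \<le> r * c"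
proof -
  have c: "0 \<le> c" using order_trans[OF norm_ge_zero assms(1)] .
  have *: "cmod (complex_of_real (w a) * U a f x) \<le> r * c"
    if f: "\<And>y. cmod (f y) \<le> c" for a f
  proof -
    have "cmod (complex_of_real (w a) * U a f x) = w a / sqrt (w a) * indicator (Cw [a]) x * cmod (f (3 * x - real a))"
      using w_pos[of a] by (auto simp: U_alt norm_mult norm_divide indicator_def)
    also have "\<dots> \<le> sqrt (w a) * c"
      using f c w_pos[of a] by (auto simp: real_div_sqrt indicator_def intro!: mult_left_mono)
    also have "\<dots> \<le> r * c" by (rule mult_right_mono[OF sqrt_w_le c])
    finally show ?thesis .
  qed
  have "U 0 g x = 0 \<or> U 2 h x = 0"
    using Cw_0_2_disjoint by (auto simp: U_def indicator_def)
  then show ?thesis using *[OF assms(1), of 0] *[OF assms(2), of 2] by auto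
qed

lemma Phi_diff_bound:
  assumes "\<And>y. cmod (T (V 0 f) y - S (V 0 f) y) \<le> c" "\<And>y. cmod (T (V 2 f) y - S (V 2 f) y) \<le> c"
  shows "cmod (Phi T f x - Phi S f x) \<le> r * c"
proof -
  have "Phi T f x - Phi S f x = complex_of_real (w 0) * U 0 (\<lambda>y. T (V 0 f) y - S (V 0 f) y) x
      + complex_of_real (w 2) * U 2 (\<lambda>y. T (V 2 f) y - S (V 2 f) y) x"
    by (simp add: Phi_def U_def algebra_simps)
  then show ?thesis using U_sum_bound[OF assms] by simp
qed

lemma Pphi_bound: "f \<in> L2 M \<Longrightarrow> cmod (Pphi p f x) \<le> L2norm M f"
  using L2inner_indicator_le[of "Cw []" f] L2norm_nonneg[of M f]
  by (auto simp: Pphi_alt norm_mult indicator_def)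

text \<open>The constant is the fixed point of \<open>b = L2norm M f + r * b\<close>, hence stable
  under one application of \<open>Phi\<close>.\<close>

lemma K_bound:
  assumes "f \<in> L2 M"
  shows "cmod (K p m f x) \<le> L2norm M f / (1 - r)"
  using assms
proof (induction m arbitrary: f x)
  case 0
  have "L2norm M f \<le> L2norm M f / (1 - r)"
    using r_bounds L2norm_nonneg[of M f] by (simp add: pos_le_divide_eq mult_left_le)
  then show ?case using Pphi_bound[OF 0, of x] by (simp add: K_0)
next
  case (Suc m)
  have b: "cmod (K p m (V a f) y) \<le> L2norm M f / (1 - r)" if a: "a \<in> {0, 2}" for a y
    using Suc.IH[OF V_L2[OF a Suc.prems], of y] V_norm_le[OF a Suc.prems] r_bounds
    by (meson diff_gt_0_iff_gt divide_right_mono less_imp_le order_trans)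
  have "cmod (K p (Suc m) f x) \<le> L2norm M f + r * (L2norm M f / (1 - r))"
    unfolding K_Suc[OF Suc.prems] Phi_def
    by (intro norm_triangle_le add_mono Pphi_bound Suc.prems U_sum_bound b) simp_all
  also have "\<dots> = L2norm M f / (1 - r)"
    using r_bounds by (simp add: field_simps)
  finally show ?case .
qed

text \<open>Each step of the induction peels one \<open>Phi\<close> off both sums and gains a factor
  \<open>r\<close>. The 2 comes from bounding the two sums separately at the start; the estimate is
  uniform in \<open>k\<close> and \<open>x\<close>.\<close>

lemma K_diff_bound:
  assumes "f \<in> L2 M"
  shows "cmod (K p (m + k) f x - K p m f x) \<le> r ^ m * (2 / (1 - r)) * L2norm M f"
  using assms
proof (induction m arbitrary: f x)
  case 0
  show ?case
    using norm_triangle_ineq4[of "K p k f x" "K p 0 f x"] K_bound[OF 0, of k x] K_bound[OF 0, of 0 x] by simp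
next
  case (Suc m)
  have b: "cmod (K p (m + k) (V a f) y - K p m (V a f) y) \<le> r ^ m * (2 / (1 - r)) * L2norm M f"
    if a: "a \<in> {0, 2}" for a y
    using Suc.IH[OF V_L2[OF a Suc.prems], of y] V_norm_le[OF a Suc.prems] r_bounds
    by (elim order_trans) (intro mult_left_mono, auto)
  have "cmod (K p (Suc m + k) f x - K p (Suc m) f x) \<le> r * (r ^ m * (2 / (1 - r)) * L2norm M f)"
    unfolding add_Suc K_Suc[OF Suc.prems] by (intro Phi_diff_bound b) simp_all
  then show ?case by (simp add: mult_ac)
qed

end

section \<open>The limit operator and uniqueness of the fixed point\<close>

context cantor_measure
begin

definition K_lim :: op where "K_lim f = (\<lambda>x. lim (\<lambda>m. K p m f x))"

lemma K_tendsto: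
  assumes f: "f \<in> L2 M" shows "(\<lambda>m. K p m f x) \<longlonglongrightarrow> K_lim f x"
proof -
  have "(\<lambda>N. r ^ N * (2 / (1 - r)) * L2norm M f) \<longlonglongrightarrow> 0 * (2 / (1 - r)) * L2norm M f"
    by (intro tendsto_intros LIMSEQ_realpow_zero r_bounds)
  then have lim: "(\<lambda>N. r ^ N * (2 / (1 - r)) * L2norm M f) \<longlonglongrightarrow> 0" by simp
  have "Cauchy (\<lambda>m. K p m f x)"
    unfolding Cauchy_altdef2
  proof (intro allI impI)
    fix e :: real assume "0 < e"
    with lim obtain N where N: "r ^ N * (2 / (1 - r)) * L2norm M f < e"
      using order_tendstoD(2)[OF lim] eventually_happens'[OF sequentially_bot] by blast
    show "\<exists>N. \<forall>n\<ge>N. dist (K p n f x) (K p N f x) < e"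
    proof (intro exI allI impI)
      fix n assume "N \<le> n"
      then obtain k where "n = N + k" using le_Suc_ex by blast
      then show "dist (K p n f x) (K p N f x) < e"
        using K_diff_bound[OF f, of N k x] N by (simp add: dist_norm)
    qed
  qed
  then show ?thesis
    unfolding K_lim_def by (simp add: Cauchy_convergent_iff convergent_LIMSEQ_iff)
qed

lemma K_lim_diff_bound:
  assumes f: "f \<in> L2 M"
  shows "cmod (K p m f x - K_lim f x) \<le> r ^ m * (2 / (1 - r)) * L2norm M f"
proof -
  have "(\<lambda>k. cmod (K p (k + m) f x - K p m f x)) \<longlonglongrightarrow> cmod (K_lim f x - K p m f x)"
    by (intro tendsto_intros LIMSEQ_ignore_initial_segment K_tendsto f)
  then have "cmod (K_lim f x - K p m f x) \<le> r ^ m * (2 / (1 - r)) * L2norm M f"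
    by (rule LIMSEQ_le_const2) (use K_diff_bound[OF f, of m _ x] in \<open>auto simp: add.commute\<close>)
  then show ?thesis by (simp add: norm_minus_commute)
qed

lemma K_lim_bound:
  assumes f: "f \<in> L2 M" shows "cmod (K_lim f x) \<le> L2norm M f / (1 - r)"
  using K_bound[OF f] by (intro LIMSEQ_le_const2[OF tendsto_norm[OF K_tendsto[OF f]]]) blast

lemma K_measurable: "K p m f \<in> borel_measurable borel"
  unfolding K_def by measurable

lemma K_lim_measurable: "K_lim f \<in> borel_measurable borel"
  unfolding K_lim_def by (rule borel_measurable_lim_metric) (rule K_measurable)

text \<open>On a probability space a uniform pointwise bound is also a bound on the norm. This suits
  \<open>K\<close> and \<open>K_lim\<close>, which are controlled at every point.\<close>

lemma bdd_opI_pointwise: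
  assumes "\<And>f. T f \<in> borel_measurable borel"
    and "\<And>f g. f \<in> L2 M \<Longrightarrow> g \<in> L2 M \<Longrightarrow> AE x in M. f x = g x \<Longrightarrow> T f = T g"
    and "\<And>f g a b x. f \<in> L2 M \<Longrightarrow> g \<in> L2 M \<Longrightarrow> T (\<lambda>y. a * f y + b * g y) x = a * T f x + b * T g x"
    and bound: "\<And>f x. f \<in> L2 M \<Longrightarrow> cmod (T f x) \<le> C * L2norm M f"
  shows "bdd_op M T"
  unfolding bdd_op_def
proof (intro conjI ballI impI allI exI[of _ C])
  fix f assume f: "f \<in> L2 M"
  show "T f \<in> L2 M" by (rule L2_bounded[OF _ bound[OF f]]) (simp add: assms(1))
  show "L2norm M (T f) \<le> C * L2norm M f" by (rule L2norm_le_bound[OF _ bound[OF f]]) (simp add: assms(1))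
next
  fix f g assume "f \<in> L2 M" "g \<in> L2 M" "AE x in M. f x = g x"
  then have "T f = T g" by (rule assms(2))
  then show "AE x in M. T f x = T g x" by simp
next
  fix f g a b assume "f \<in> L2 M" "g \<in> L2 M"
  then show "AE x in M. T (\<lambda>y. a * f y + b * g y) x = a * T f x + b * T g x"
    using assms(3) by (intro AE_I2) blast
qed

lemma K_linear:
  assumes "f \<in> L2 M" "g \<in> L2 M"
  shows "K p m (\<lambda>y. a * f y + b * g y) x = a * K p m f x + b * K p m g x"
  unfolding K_def L2inner_linear[OF L2_indicator_Cw assms]
  by (simp add: sum_distrib_left sum.distrib distrib_right mult.assoc)

lemma K_bdd_op: "bdd_op M (K p m)"
  by (rule bdd_opI_pointwise[where C="1 / (1 - r)"])
     (rule K_measurable, erule (2) K_cong_AE, erule (1) K_linear, use K_bound in simp)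

lemma K_lim_bdd_op: "bdd_op M K_lim"
proof (rule bdd_opI_pointwise[where C="1 / (1 - r)"])
  fix f g a b x assume fg: "f \<in> L2 M" "g \<in> L2 M"
  have "(\<lambda>m. a * K p m f x + b * K p m g x) \<longlonglongrightarrow> a * K_lim f x + b * K_lim g x"
    by (intro tendsto_intros K_tendsto fg)
  moreover have "(\<lambda>m. a * K p m f x + b * K p m g x) \<longlonglongrightarrow> K_lim (\<lambda>y. a * f y + b * g y) x"
    unfolding K_linear[OF fg, symmetric] by (intro K_tendsto L2_add L2_cmult fg)
  ultimately show "K_lim (\<lambda>y. a * f y + b * g y) x = a * K_lim f x + b * K_lim g x"
    by (rule LIMSEQ_unique[rotated])
next
  fix f g assume "f \<in> L2 M" "g \<in> L2 M" "AE x in M. f x = g x"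
  then have "K p m f = K p m g" for m by (rule K_cong_AE)
  then show "K_lim f = K_lim g" by (simp add: K_lim_def)
qed (use K_lim_bound K_lim_measurable in simp_all)

lemma op_dist_K_lim: "(\<lambda>m. op_dist M (K p m) K_lim) \<longlonglongrightarrow> 0"
proof (rule tendsto_sandwich[where f="\<lambda>_. 0" and h="\<lambda>m. r ^ m * (2 / (1 - r))"])
  have "(\<lambda>N. r ^ N * (2 / (1 - r))) \<longlonglongrightarrow> 0 * (2 / (1 - r))"
    by (intro tendsto_intros LIMSEQ_realpow_zero r_bounds)
  then show "(\<lambda>N. r ^ N * (2 / (1 - r))) \<longlonglongrightarrow> 0" by simp
  \<comment> \<open>The zero function shows that the set under \<open>Sup\<close> is nonempty and
    that the distance is nonnegative.\<close>
  have z: "(\<lambda>_. 0) \<in> L2 M" "L2norm M (\<lambda>_. 0) \<le> 1" by (simp_all add: L2_def L2norm_def)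
  have "0 \<le> op_dist M (K p m) K_lim" for m
    using op_dist_upper[OF K_bdd_op K_lim_bdd_op z] L2norm_nonneg order_trans by blast
  then show "\<forall>\<^sub>F m in sequentially. 0 \<le> op_dist M (K p m) K_lim" by simp
  have "op_dist M (K p m) K_lim \<le> r ^ m * (2 / (1 - r))" for m
    unfolding op_dist_def
  proof (rule cSup_least)
    show "{L2norm M (\<lambda>x. K p m f x - K_lim f x) |f. f \<in> L2 M \<and> L2norm M f \<le> 1} \<noteq> {}"
      using z by blast
    fix y assume "y \<in> {L2norm M (\<lambda>x. K p m f x - K_lim f x) |f. f \<in> L2 M \<and> L2norm M f \<le> 1}"
    then obtain f where f: "f \<in> L2 M" "L2norm M f \<le> 1" and y: "y = L2norm M (\<lambda>x. K p m f x - K_lim f x)"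
      by blast
    have "y \<le> r ^ m * (2 / (1 - r)) * L2norm M f"
      unfolding y by (rule L2norm_le_bound) (use K_measurable K_lim_measurable K_lim_diff_bound[OF f(1)] in auto)
    also have "\<dots> \<le> r ^ m * (2 / (1 - r))"
      using f(2) r_bounds by (intro mult_left_le) auto
    finally show "y \<le> r ^ m * (2 / (1 - r))" .
  qed
  then show "\<forall>\<^sub>F m in sequentially. op_dist M (K p m) K_lim \<le> r ^ m * (2 / (1 - r))" by simp
qed simp

section \<open>Identification of \<open>K_inf\<close> and its fixed-point equation\<close>

lemma K_inf_limit: "bdd_op M (K_inf p)" "(\<lambda>m. op_dist M (K p m) (K_inf p)) \<longlonglongrightarrow> 0"
proof -
  have "bdd_op M (K_inf p) \<and> (\<lambda>m. op_dist M (K p m) (K_inf p)) \<longlonglongrightarrow> 0"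
    unfolding K_inf_def by (rule someI[of _ K_lim]) (use K_lim_bdd_op op_dist_K_lim in blast)
  then show "bdd_op M (K_inf p)" "(\<lambda>m. op_dist M (K p m) (K_inf p)) \<longlonglongrightarrow> 0" by auto
qed

text \<open>\<open>K_inf\<close> is a mere choice among norm limits; this ties it to the explicit
  \<open>K_lim\<close>, up to null sets.\<close>

lemma op_limit_unique:
  assumes T: "bdd_op M T" "(\<lambda>m. op_dist M (A m) T) \<longlonglongrightarrow> 0"
    and S: "bdd_op M S" "(\<lambda>m. op_dist M (A m) S) \<longlonglongrightarrow> 0"
    and A: "\<And>m. bdd_op M (A m)"
  shows "op_eq M T S"
  unfolding op_eq_def
proof
  fix f assume f: "f \<in> L2 M"
  have d: "(\<lambda>x. T f x - S f x) \<in> L2 M"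
    by (intro L2_diff bdd_opD(1)[OF T(1)] bdd_opD(1)[OF S(1)] f)
  have "(L2norm M (\<lambda>x. T f x - S f x))\<^sup>2 \<le>
      2 * (op_dist M (A m) S * L2norm M f)\<^sup>2 + 2 * (op_dist M (A m) T * L2norm M f)\<^sup>2" for m
  proof -
    have "(L2norm M (\<lambda>x. T f x - S f x))\<^sup>2 = (L2norm M (\<lambda>x. (A m f x - S f x) - (A m f x - T f x)))\<^sup>2"
      by simp
    also have "\<dots> \<le> 2 * (L2norm M (\<lambda>x. A m f x - S f x))\<^sup>2 + 2 * (L2norm M (\<lambda>x. A m f x - T f x))\<^sup>2"
      by (intro L2norm_diff_power2_le L2_diff bdd_opD(1)[OF A] bdd_opD(1)[OF T(1)] bdd_opD(1)[OF S(1)] f)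
    also have "\<dots> \<le> 2 * (op_dist M (A m) S * L2norm M f)\<^sup>2 + 2 * (op_dist M (A m) T * L2norm M f)\<^sup>2"
      by (intro add_mono mult_left_mono power_mono op_dist_bound A T S f L2norm_nonneg) auto
    finally show ?thesis .
  qed
  moreover have "(\<lambda>m. 2 * (op_dist M (A m) S * L2norm M f)\<^sup>2 + 2 * (op_dist M (A m) T * L2norm M f)\<^sup>2)
      \<longlonglongrightarrow> 2 * (0 * L2norm M f)\<^sup>2 + 2 * (0 * L2norm M f)\<^sup>2"
    by (intro tendsto_intros T S)
  ultimately have "(L2norm M (\<lambda>x. T f x - S f x))\<^sup>2 \<le> 2 * (0 * L2norm M f)\<^sup>2 + 2 * (0 * L2norm M f)\<^sup>2"
    by (intro LIMSEQ_le_const) blast+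
  then have "AE x in M. T f x - S f x = 0"
    using L2norm_eq_0_iff[OF d] by simp
  then show "AE x in M. T f x = S f x" by simp
qed

lemma K_inf_eq_K_lim: "op_eq M (K_inf p) K_lim"
  by (rule op_limit_unique[OF K_inf_limit K_lim_bdd_op op_dist_K_lim K_bdd_op])

text \<open>At a fixed \<open>x\<close>, \<open>Phi\<close> depends on its operator only through two
  point values, so pointwise convergence passes through it.\<close>

lemma K_lim_fixed:
  assumes f: "f \<in> L2 M" shows "K_lim f x = Phi K_lim f x"
proof -
  have "(\<lambda>m. Phi (K p m) f x) \<longlonglongrightarrow> Phi K_lim f x"
    unfolding Phi_def U_def by (intro tendsto_intros K_tendsto V_L2 f) simp_all
  moreover have "(\<lambda>m. Phi (K p m) f x) \<longlonglongrightarrow> K_lim f x"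
    unfolding K_Suc[OF f, symmetric] by (rule LIMSEQ_Suc[OF K_tendsto[OF f]])
  ultimately show ?thesis by (rule LIMSEQ_unique[rotated])
qed

lemma K_inf_fixed: "op_eq M (K_inf p) (Psi p (K_inf p))"
  unfolding op_eq_def
proof
  fix f assume f: "f \<in> L2 M"
  have "AE x in M. K_inf p f x = K_lim f x" "AE x in M. Psi p (K_inf p) f x = Psi p K_lim f x"
    using K_inf_eq_K_lim Psi_cong[OF K_inf_eq_K_lim] f unfolding op_eq_def by blast+
  moreover have "AE x in M. Psi p K_lim f x = Phi K_lim f x"
    by (rule Psi_eq_Phi[OF f]) (rule bdd_opD(2)[OF K_lim_bdd_op])
  ultimately show "AE x in M. K_inf p f x = Psi p (K_inf p) f x"
    by eventually_elim (use K_lim_fixed[OF f] in simp)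
qed

section \<open>Uniqueness of the fixed point\<close>

lemma U_sum_norm:
  assumes g: "g \<in> L2 M" and h: "h \<in> L2 M"
  shows "(L2norm M (\<lambda>x. c * U 0 g x + d * U 2 h x))\<^sup>2 = (cmod c * L2norm M g)\<^sup>2 + (cmod d * L2norm M h)\<^sup>2"
proof -
  have U: "U 0 g \<in> L2 M" "U 2 h \<in> L2 M" using U_L2(1) g h by auto
  have "(cmod (c * U 0 g x + d * U 2 h x))\<^sup>2 = (cmod c)\<^sup>2 * (cmod (U 0 g x))\<^sup>2 + (cmod d)\<^sup>2 * (cmod (U 2 h x))\<^sup>2" for x
  proof -
    \<comment> \<open>Orthogonality of the ranges in pointwise form: the cross terms vanish at every
      \<open>x\<close>.\<close>
    have "U 0 g x = 0 \<or> U 2 h x = 0"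
      using Cw_0_2_disjoint by (auto simp: U_def indicator_def)
    then show ?thesis by (auto simp: norm_mult power_mult_distrib)
  qed
  then have "(L2norm M (\<lambda>x. c * U 0 g x + d * U 2 h x))\<^sup>2 =
      (cmod c)\<^sup>2 * (L2norm M (U 0 g))\<^sup>2 + (cmod d)\<^sup>2 * (L2norm M (U 2 h))\<^sup>2"
    using L2_integrable[OF U(1)] L2_integrable[OF U(2)] by (simp add: L2norm_power2)
  then show ?thesis using U_L2(2) g h by (simp add: power_mult_distrib)
qed

text \<open>An arbitrary bounded operator has no pointwise bound, so the contraction is carried out
  in squared norms. The \<open>Pphi\<close> terms cancel in the difference \<open>R\<close>.\<close>

lemma fixed_point_unique:
  assumes T: "bdd_op M T" "op_eq M T (Psi p T)" and S: "bdd_op M S" "op_eq M S (Psi p S)"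
  shows "op_eq M T S"
proof -
  define R where "R f = (\<lambda>x. T f x - S f x)" for f
  define q where "q = max p (1 - p)"
  have q: "0 \<le> q" "q < 1" using p_pos p_less by (auto simp: q_def)
  have wq: "w a \<le> q" for a by (auto simp: w_def q_def)
  have R_L2: "R f \<in> L2 M" if "f \<in> L2 M" for f
    unfolding R_def by (intro L2_diff bdd_opD(1)[OF T(1)] bdd_opD(1)[OF S(1)] that)
  have fixed: "AE x in M. A f x = Phi A f x" if A: "bdd_op M A" "op_eq M A (Psi p A)" and f: "f \<in> L2 M" for A f
  proof -
    have "AE x in M. A f x = Psi p A f x" using A(2) f unfolding op_eq_def by blast
    moreover have "AE x in M. Psi p A f x = Phi A f x"
      by (rule Psi_eq_Phi[OF f]) (rule bdd_opD(2)[OF A(1)])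
    ultimately show ?thesis by eventually_elim simp
  qed
  have rec: "(L2norm M (R f))\<^sup>2 = (w 0 * L2norm M (R (V 0 f)))\<^sup>2 + (w 2 * L2norm M (R (V 2 f)))\<^sup>2"
    if f: "f \<in> L2 M" for f
  proof -
    let ?g = "\<lambda>x. complex_of_real (w 0) * U 0 (R (V 0 f)) x + complex_of_real (w 2) * U 2 (R (V 2 f)) x"
    have "AE x in M. R f x = ?g x"
      using fixed[OF T f] fixed[OF S f]
      by eventually_elim (simp add: R_def Phi_def U_def algebra_simps)
    moreover have "?g \<in> L2 M"
      by (intro L2_add L2_cmult U_L2 R_L2 V_L2 f) simp_all
    ultimately have "L2norm M (R f) = L2norm M ?g"
      by (intro L2norm_cong_AE L2_measurable[OF R_L2[OF f]] L2_measurable)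
    also have "(L2norm M ?g)\<^sup>2 = (w 0 * L2norm M (R (V 0 f)))\<^sup>2 + (w 2 * L2norm M (R (V 2 f)))\<^sup>2"
      using w_pos[of 0] w_pos[of 2] by (subst U_sum_norm) (simp_all add: R_L2 V_L2 f)
    finally show ?thesis .
  qed
  obtain C where C: "0 \<le> C" "\<And>f. f \<in> L2 M \<Longrightarrow> (L2norm M (R f))\<^sup>2 \<le> C * (L2norm M f)\<^sup>2"
    using bdd_op_diff_bound[OF T(1) S(1)] unfolding R_def by blast
  have decay: "(L2norm M (R f))\<^sup>2 \<le> (q\<^sup>2) ^ n * C * (L2norm M f)\<^sup>2" if "f \<in> L2 M" for f n
    using that
  proof (induction n arbitrary: f)
    case 0
    then show ?case using C(2) by simp
  next
    case (Suc n)
    have b: "(w a * L2norm M (R (V a f)))\<^sup>2 \<le> q\<^sup>2 * ((q\<^sup>2) ^ n * C * (L2norm M (V a f))\<^sup>2)" if a: "a \<in> {0, 2}" for a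
      unfolding power_mult_distrib
      by (intro mult_mono power_mono wq Suc.IH V_L2 a Suc.prems) (use w_pos[of a] in auto)
    have "(L2norm M (R f))\<^sup>2 \<le> q\<^sup>2 * ((q\<^sup>2) ^ n * C * (L2norm M (V 0 f))\<^sup>2) + q\<^sup>2 * ((q\<^sup>2) ^ n * C * (L2norm M (V 2 f))\<^sup>2)"
      unfolding rec[OF Suc.prems] by (intro add_mono b) simp_all
    \<comment> \<open>The two branch norms are kept together for \<open>V_norm_sum\<close>, so a
      step costs the factor \<open>q\<^sup>2\<close> and not twice that.\<close>
    also have "\<dots> = (q\<^sup>2) ^ Suc n * C * ((L2norm M (V 0 f))\<^sup>2 + (L2norm M (V 2 f))\<^sup>2)"
      by (simp add: algebra_simps)
    finally show ?case unfolding V_norm_sum[OF Suc.prems] .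
  qed
  show ?thesis unfolding op_eq_def
  proof
    fix f assume f: "f \<in> L2 M"
    have "q\<^sup>2 < 1" using q by (simp add: abs_square_less_1)
    then have "(\<lambda>n. (q\<^sup>2) ^ n * C * (L2norm M f)\<^sup>2) \<longlonglongrightarrow> 0 * C * (L2norm M f)\<^sup>2"
      by (intro tendsto_intros LIMSEQ_realpow_zero) simp_all
    then have "(L2norm M (R f))\<^sup>2 \<le> 0 * C * (L2norm M f)\<^sup>2"
      by (rule LIMSEQ_le_const) (use decay[OF f] in blast)
    then have "AE x in M. R f x = 0" using L2norm_eq_0_iff[OF R_L2[OF f]] by simp
    then show "AE x in M. T f x = S f x" by (simp add: R_def)
  qed
qed

end

theorem theorem6p3:
  fixes p :: real
  assumes "0 < p" and "p < 1"
  shows "(\<forall>m. op_eq (mu p) (K p (Suc m)) (Psi p (K p m))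
               \<and> op_eq (mu p) (K p m) ((Psi p ^^ m) (Pphi p)))
         \<and> op_eq (mu p) (K_inf p) (Psi p (K_inf p))
         \<and> bdd_op (mu p) (K_inf p)
         \<and> (\<forall>T. bdd_op (mu p) T \<and> op_eq (mu p) T (Psi p T) \<longrightarrow> op_eq (mu p) T (K_inf p))"
proof -
  interpret cantor_measure p by standard (use assms in auto)
  show ?thesis
    using K_Suc_eq_Psi K_eq_Psi_power K_inf_fixed K_inf_limit(1) fixed_point_unique by blast
qed

end
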